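(* Consider a load balancing system operating under Join the Shortest Queue (JSQ), parametrized by the number of servers $N$ as described in the context (with $\alpha>0$). Let $\delta\in(0,1)$ and $N_0\in\mathbb Z_+$ be such that $\delta\le 1-N^{-\alpha}$ for all $N\ge N_0$. Then there exists a finite constant $C$ (not depending on $N$ or $r$) such that, for $N\ge N_0$ and any integer $r\ge1$, $$\mathbb E\left[\left\|\overline{\boldsymbol q}_\perp^{(N)}\right\|^r\right]^{\frac1r}\le C\,r\,N^3 .$$ Additionally, if $$\theta\le\frac{1}{4A_{\max}N^{\frac52-\alpha}}\log\left(1+\frac{\delta}{4A_{\max}N^{\frac32}}\right),$$ then $$\mathbb E\left[\exp\left(\theta N^{1-\alpha}\left\|\overline{\boldsymbol q}_\perp^{(N)}\right\|\right)\right]\le\frac{\delta\exp\left(\frac{2\theta N^{3-\alpha}}{\delta}\right)}{\delta+4A_{\max}N^{\frac32}\left(1-\exp\left(4\theta A_{\max}N^{\frac52-\alpha}\right)\right)} .$$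
   Context: Model (for each $N$). A discrete-time system has $N$ parallel servers, each with its own infinite-buffer queue; time slots are $k\in\mathbb Z_+$. $q_i^{(N)}(k)\in\mathbb Z_+$ is the number of jobs in queue $i$ at the beginning of slot $k$. $a^{(N)}(k)\in\mathbb Z_+$ is the total number of arrivals in slot $k$, i.i.d. in $k$; $\boldsymbol s(k)=(s_1(k),\dots,s_N(k))\in\mathbb Z_+^N$ is the vector of potential services, i.i.d. in $k$. The sequences $\{a^{(N)}(k)\}_k$, $\{s_1(k)\}_k,\dots,\{s_N(k)\}_k$ are mutually independent, and in slot $k$ the variables $a^{(N)}(k),\boldsymbol s(k)$ are independent of the queue lengths up to and including $\boldsymbol q^{(N)}(k)$. There are finite constants $A_{\max},S_{\max}$, not depending on $N$, with $a^{(N)}(1)\le N A_{\max}$ and $s_i(1)\le S_{\max}$ for all $i$ almost surely. Moments: with $\alpha>0$ a fixed parameter and $\sigma_a^2,\sigma_s^2$ constants not depending on $N$: $\mathbb E[s_i(1)]=1$, $\mathrm{Var}[s_i(1)]=\sigma_s^2$ for every $i$, $\mathbb E[a^{(N)}(1)]=N(1-N^{-\alpha})$, $\mathrm{Var}[a^{(N)}(1)]=N\sigma_a^2$. Routing (JSQ): all arrivals of slot $k$ are sent to one queue $i^*(k)\in\arg\min_{i} q_i^{(N)}(k)$, ties broken at random; so $a_i^{(N)}(k)=a^{(N)}(k)$ if $i=i^*(k)$ and $0$ otherwise. Dynamics: $q_i^{(N)}(k+1)=\max\{q_i^{(N)}(k)+a_i^{(N)}(k)-s_i(k),0\}$ for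 every $i$. It is assumed that $\mathbb P[a^{(N)}(k)-s_i(k)=0]>0$ for some $i$. The Markov chain $\{\boldsymbol q^{(N)}(k)\}_k$ is positive recurrent and aperiodic, and $\overline{\boldsymbol q}^{(N)}$ denotes the steady-state random vector to which $\boldsymbol q^{(N)}(k)$ converges in distribution. Notation: for $\boldsymbol x\in\mathbb R^N$, $\boldsymbol x_\parallel=\big(\frac1N\sum_{i=1}^N x_i\big)\boldsymbol 1$ with $\boldsymbol 1$ the all-ones vector, and $\boldsymbol x_\perp=\boldsymbol x-\boldsymbol x_\parallel$; $\|\cdot\|$ is the Euclidean norm; $\log$ is the natural logarithm.
   Formalization: The exponential bound is proved for θ ≥ 0 and for those N with S_max ≤ N·A_max; without these conditions it is false in general (e.g. N = 2 with rare, very large services, or θ slightly negative). The moment bound is proved for every N ≥ N_0. *)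

theory Defs
  imports "HOL-Probability.Probability"
begin

text \<open>
  A vector in \<open>\<real>\<^sup>N\<close> is a function on \<^typ>\<open>nat\<close> of which only the values at the indices
  \<open>i < N\<close> (the servers, numbered from \<open>0\<close>) are used.
\<close>

definition par :: "nat \<Rightarrow> (nat \<Rightarrow> real) \<Rightarrow> nat \<Rightarrow> real" where
  "par N x = (\<lambda>i. (1 / real N) * (\<Sum>j<N. x j))"

definition perp :: "nat \<Rightarrow> (nat \<Rightarrow> real) \<Rightarrow> nat \<Rightarrow> real" where
  "perp N x = (\<lambda>i. x i - par N x i)"

definition perp_norm :: "nat \<Rightarrow> (nat \<Rightarrow> nat) \<Rightarrow> real" where
  "perp_norm N q = L2_set (perp N (\<lambda>i. real (q i))) {..<N}"

definition shortest :: "nat \<Rightarrow> (nat \<Rightarrow> nat) \<Rightarrow> nat set" where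
  "shortest N q = {i. is_arg_min q (\<lambda>i. i < N) i}"

locale jsq_system = prob_space M
  for M :: "'w measure"
    and N :: nat
    and \<alpha> Amax Smax \<sigma>a \<sigma>s :: real
    and a :: "nat \<Rightarrow> 'w \<Rightarrow> nat"                 \<comment> \<open>\<open>a k\<close>: total arrivals in slot \<open>k\<close>\<close>
    and s :: "nat \<Rightarrow> nat \<Rightarrow> 'w \<Rightarrow> nat"          \<comment> \<open>\<open>s i k\<close>: potential service of server \<open>i\<close> in slot \<open>k\<close>\<close>
    and istar :: "nat \<Rightarrow> 'w \<Rightarrow> nat"             \<comment> \<open>\<open>istar k\<close>: queue receiving the arrivals of slot \<open>k\<close>\<close>
    and q :: "nat \<Rightarrow> 'w \<Rightarrow> nat \<Rightarrow> nat" +        \<comment> \<open>\<open>q k \<omega> i\<close>: length of queue \<open>i\<close> at the start of slot \<open>k\<close>\<close>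
  assumes measurable_q: "\<And>k i. i < N \<Longrightarrow> (\<lambda>\<omega>. q k \<omega> i) \<in> M \<rightarrow>\<^sub>M count_space UNIV"
    and measurable_istar: "\<And>k. istar k \<in> M \<rightarrow>\<^sub>M count_space UNIV"
    \<comment> \<open>Independence over slots and mutual independence of the \<open>N + 1\<close> sequences together mean
        joint independence of all the variables. The index \<open>None\<close> stands for the arrivals and
        \<open>Some i\<close> for server \<open>i\<close>. Measurability of \<open>a k\<close> and \<open>s i k\<close> is part of \<^const>\<open>indep_vars\<close>.\<close>
    and indep_a_s: "indep_vars (\<lambda>_. count_space UNIV)
          (\<lambda>(j, k). case j of None \<Rightarrow> a k | Some i \<Rightarrow> s i k)
          (insert None (Some ` {..<N}) \<times> UNIV)"
    and ident_a: "\<And>k. distr M (count_space UNIV) (a k) = distr M (count_space UNIV) (a 1)"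
    and ident_s: "\<And>i k. i < N \<Longrightarrow>
          distr M (count_space UNIV) (s i k) = distr M (count_space UNIV) (s i 1)"
    \<comment> \<open>\<open>(a k, s k)\<close> is independent of the queue lengths in slots \<open>0, \<dots>, k\<close>. All variables are
        discrete, so this is stated on elementary events.\<close>
    and indep_history: "\<And>k m v x.
          prob {\<omega> \<in> space M. a k \<omega> = m \<and> (\<forall>j<N. s j k \<omega> = v j) \<and>
                  (\<forall>l\<le>k. \<forall>j<N. q l \<omega> j = x l j)}
          = prob {\<omega> \<in> space M. a k \<omega> = m \<and> (\<forall>j<N. s j k \<omega> = v j)} *
            prob {\<omega> \<in> space M. \<forall>l\<le>k. \<forall>j<N. q l \<omega> j = x l j}"
    and bound_a: "AE \<omega> in M. real (a 1 \<omega>) \<le> real N * Amax"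
    and bound_s: "\<And>i. i < N \<Longrightarrow> AE \<omega> in M. real (s i 1 \<omega>) \<le> Smax"
    and mean_s: "\<And>i. i < N \<Longrightarrow> expectation (\<lambda>\<omega>. real (s i 1 \<omega>)) = 1"
    and var_s: "\<And>i. i < N \<Longrightarrow> variance (\<lambda>\<omega>. real (s i 1 \<omega>)) = \<sigma>s\<^sup>2"
    and mean_a: "expectation (\<lambda>\<omega>. real (a 1 \<omega>)) = real N * (1 - real N powr (-\<alpha>))"
    and var_a: "variance (\<lambda>\<omega>. real (a 1 \<omega>)) = real N * \<sigma>a\<^sup>2"
    and route_shortest: "\<And>k \<omega>. \<omega> \<in> space M \<Longrightarrow> istar k \<omega> \<in> shortest N (q k \<omega>)"
    \<comment> \<open>Random tie-breaking: given the queue lengths up to slot \<open>k\<close> and the arrivals and services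
        of slot \<open>k\<close>, \<open>istar k\<close> is uniform on the set of shortest queues. Again on elementary events,
        with the conditional probability multiplied out.\<close>
    and route_uniform: "\<And>k i m v x. i < N \<Longrightarrow>
          prob {\<omega> \<in> space M. istar k \<omega> = i \<and> a k \<omega> = m \<and> (\<forall>j<N. s j k \<omega> = v j) \<and>
                  (\<forall>l\<le>k. \<forall>j<N. q l \<omega> j = x l j)}
          = pmf (pmf_of_set (shortest N (x k))) i *
            prob {\<omega> \<in> space M. a k \<omega> = m \<and> (\<forall>j<N. s j k \<omega> = v j) \<and>
                  (\<forall>l\<le>k. \<forall>j<N. q l \<omega> j = x l j)}"
    and dynamics: "\<And>k i \<omega>. i < N \<Longrightarrow> \<omega> \<in> space M \<Longrightarrow>
          int (q (Suc k) \<omega> i) =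
            max (int (q k \<omega> i) + int (if i = istar k \<omega> then a k \<omega> else 0) - int (s i k \<omega>)) 0"
    and no_change: "\<exists>i<N. \<forall>k. prob {\<omega> \<in> space M. int (a k \<omega>) - int (s i k \<omega>) = 0} > 0"

definition converges_in_distribution ::
  "'w measure \<Rightarrow> (nat \<Rightarrow> 'w \<Rightarrow> 'b::topological_space) \<Rightarrow> 'v measure \<Rightarrow> ('v \<Rightarrow> 'b) \<Rightarrow> bool"
  where
  "converges_in_distribution M X M' Y \<longleftrightarrow>
     (\<forall>f :: 'b \<Rightarrow> real. continuous_on UNIV f \<and> bounded (range f) \<longrightarrow>
        (\<lambda>k. \<integral>\<omega>. f (X k \<omega>) \<partial>M) \<longlonglongrightarrow> (\<integral>\<omega>. f (Y \<omega>) \<partial>M'))"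

text \<open>
  The steady-state vector may live on a probability space of its own. The type
  \<^typ>\<open>nat \<Rightarrow> nat\<close> carries the product of the discrete topologies, and restricting to the
  indices below \<open>N\<close> leaves the discrete space \<open>\<nat>\<^sup>N\<close>.
\<close>

definition steady_state ::
  "nat \<Rightarrow> 'w measure \<Rightarrow> (nat \<Rightarrow> 'w \<Rightarrow> nat \<Rightarrow> nat) \<Rightarrow> 'v measure \<Rightarrow> ('v \<Rightarrow> nat \<Rightarrow> nat) \<Rightarrow> bool" where
  "steady_state N M q M' qbar \<longleftrightarrow>
     prob_space M' \<and>
     (\<forall>i<N. (\<lambda>\<omega>. qbar \<omega> i) \<in> M' \<rightarrow>\<^sub>M count_space UNIV) \<and>
     converges_in_distribution M (\<lambda>k \<omega>. restrict (q k \<omega>) {..<N}) M' (\<lambda>\<omega>. restrict (qbar \<omega>) {..<N})"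

end

theory Submission
  imports Defs
begin

text \<open>
  The expected one-step change of \<open>\<parallel>q\<^sub>\<bottom>\<parallel>\<^sup>2\<close> is at most \<open>B\<^sup>2 - 2 \<delta> \<parallel>q\<^sub>\<bottom>\<parallel>\<close>, where
  \<open>B = N\<^sup>3\<^sup>/\<^sup>2 A\<close> bounds the length of a step: the reflection at \<open>0\<close> does not increase \<open>\<parallel>q\<^sub>\<bottom>\<parallel>\<close>, and
  sending the arrivals to a shortest queue contributes minus the arrivals times the gap
  between the mean and the smallest queue, which is at least \<open>\<parallel>q\<^sub>\<bottom>\<parallel> / N\<close>. This value does not depend
  on how ties are broken. For \<open>Y = (\<parallel>q\<^sub>\<bottom>\<parallel>\<^sup>2 + u\<^sup>2)\<^sup>1\<^sup>/\<^sup>2\<close> with \<open>u = B\<^sup>2 / \<delta>\<close> and the exponent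
  \<open>\<theta>\<^sub>0 = \<delta> / (4 B\<^sup>2)\<close> this gives a geometric drift inequality for \<open>exp (\<theta>\<^sub>0 Y)\<close>. Truncated at a level
  \<open>L\<close>, it passes to the limit in distribution, whatever the initial state; letting \<open>L\<close> grow yields
  \<open>E exp (\<theta>\<^sub>0 \<parallel>q\<^sub>\<bottom>\<parallel>) \<le> e\<^sup>4\<close> in steady state.

  The moments follow from \<open>x\<^sup>r / r! \<le> e\<^sup>x\<close>. For a smaller exponent \<open>\<tau>\<close>, convexity of \<open>exp\<close> gives
  \<open>E exp (\<tau> \<parallel>q\<^sub>\<bottom>\<parallel>) \<le> exp (4 \<tau> / \<theta>\<^sub>0) = exp (16 \<tau> B\<^sup>2 / \<delta>)\<close>, which is already below the claimed
  quotient without its exponential factor, since \<open>e\<^sup>t (1 - t) \<le> 1\<close>.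
\<close>

lemma sum_perp:
  assumes "0 < N"
  shows "(\<Sum>i<N. perp N x i) = 0"
  using assms by (simp add: perp_def par_def sum_subtractf)

lemma perp_cong:
  assumes "\<And>i. i < N \<Longrightarrow> x i = y i" "i < N"
  shows "perp N x i = perp N y i"
  using assms by (simp add: perp_def par_def)

lemma perp_norm_cong:
  assumes "\<And>i. i < N \<Longrightarrow> x i = y i"
  shows "perp_norm N x = perp_norm N y"
  unfolding perp_norm_def
  by (rule L2_set_cong) (auto intro!: perp_cong simp: assms)

lemma perp_norm_nonneg: "0 \<le> perp_norm N x"
  by (simp add: perp_norm_def)

lemma L2_set_square: "(L2_set f A)\<^sup>2 = (\<Sum>i\<in>A. (f i)\<^sup>2)"
  by (simp add: L2_set_def sum_nonneg)

lemma L2_set_perp_le: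
  assumes "0 < N"
  shows "L2_set (perp N x) {..<N} \<le> L2_set (\<lambda>i. x i - c) {..<N}"
proof -
  define e where "e = par N x 0 - c"
  have "x i - c = perp N x i + e" for i
    by (simp add: e_def perp_def par_def)
  then have "(\<Sum>i<N. (x i - c)\<^sup>2) = (\<Sum>i<N. (perp N x i + e)\<^sup>2)"
    by (simp only:)
  also have "\<dots> = (\<Sum>i<N. (perp N x i)\<^sup>2) + 2 * e * (\<Sum>i<N. perp N x i) + real N * e\<^sup>2"
    by (simp add: power2_sum sum.distrib sum_distrib_left mult_ac)
  finally have "(\<Sum>i<N. (perp N x i)\<^sup>2) \<le> (\<Sum>i<N. (x i - c)\<^sup>2)"
    using assms by (simp add: sum_perp)
  then show ?thesis
    by (simp add: L2_set_def)
qed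

lemma L2_set_perp_max_le:
  assumes "0 < N"
  shows "L2_set (perp N (\<lambda>i. max (x i) 0)) {..<N} \<le> L2_set (perp N x) {..<N}"
proof -
  let ?m = "par N x 0"
  have "L2_set (perp N (\<lambda>i. max (x i) 0)) {..<N} \<le> L2_set (\<lambda>i. max (x i) 0 - max ?m 0) {..<N}"
    by (rule L2_set_perp_le[OF assms])
  also have "\<dots> \<le> L2_set (perp N x) {..<N}"
    unfolding L2_set_def
  proof (intro real_sqrt_le_mono sum_mono)
    fix i
    have "\<bar>max (x i) 0 - max ?m 0\<bar> \<le> \<bar>x i - ?m\<bar>"
      by (auto simp: max_def)
    moreover have "perp N x i = x i - ?m"
      by (simp add: perp_def par_def)
    ultimately show "(max (x i) 0 - max ?m 0)\<^sup>2 \<le> (perp N x i)\<^sup>2"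
      by (metis abs_le_square_iff)
  qed
  finally show ?thesis .
qed

lemma perp_add: "perp N (\<lambda>i. x i + y i) i = perp N x i + perp N y i"
  by (simp add: perp_def par_def sum.distrib algebra_simps)

lemma L2_set_perp_add_square:
  assumes "0 < N"
  shows "(L2_set (perp N (\<lambda>i. x i + d i)) {..<N})\<^sup>2
    = (L2_set (perp N x) {..<N})\<^sup>2 + 2 * (\<Sum>i<N. perp N x i * d i) + (L2_set (perp N d) {..<N})\<^sup>2"
proof -
  have "(\<Sum>i<N. perp N x i * perp N d i) = (\<Sum>i<N. perp N x i * d i) - (\<Sum>i<N. perp N x i) * par N d 0"
    by (simp add: perp_def[of N d] par_def right_diff_distrib sum_subtractf sum_distrib_right sum_divide_distrib)
  then have "(\<Sum>i<N. perp N x i * perp N d i) = (\<Sum>i<N. perp N x i * d i)"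
    using assms by (simp add: sum_perp)
  then show ?thesis
    by (simp add: L2_set_square perp_add power2_sum sum.distrib sum_distrib_left[symmetric] mult.assoc)
qed

lemma L2_set_perp_diff_le:
  assumes "0 < N"
  shows "\<bar>L2_set (perp N x) {..<N} - L2_set (perp N y) {..<N}\<bar> \<le> L2_set (\<lambda>i. x i - y i) {..<N}"
proof -
  have *: "L2_set (perp N x) {..<N} \<le> L2_set (perp N y) {..<N} + L2_set (\<lambda>i. x i - y i) {..<N}"
    for x y :: "nat \<Rightarrow> real"
  proof -
    have "L2_set (perp N x) {..<N} = L2_set (perp N (\<lambda>i. y i + (x i - y i))) {..<N}"
      by simp
    also have "\<dots> = L2_set (\<lambda>i. perp N y i + perp N (\<lambda>i. x i - y i) i) {..<N}"
      by (rule L2_set_cong) (use perp_add[of N y "\<lambda>i. x i - y i"] in simp_all)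
    also have "\<dots> \<le> L2_set (perp N y) {..<N} + L2_set (perp N (\<lambda>i. x i - y i)) {..<N}"
      by (rule L2_set_triangle_ineq)
    also have "L2_set (perp N (\<lambda>i. x i - y i)) {..<N} \<le> L2_set (\<lambda>i. x i - y i) {..<N}"
      using L2_set_perp_le[OF assms, of _ 0] by simp
    finally show ?thesis by simp
  qed
  have "L2_set (\<lambda>i. y i - x i) {..<N} = L2_set (\<lambda>i. x i - y i) {..<N}"
    by (simp add: L2_set_def power2_commute)
  then show ?thesis
    using *[of x y] *[of y x] by linarith
qed

lemma L2_set_le_bound:
  assumes "\<And>i. i < N \<Longrightarrow> \<bar>d i\<bar> \<le> real N * A" "0 \<le> A"
  shows "L2_set d {..<N} \<le> real N powr (3/2) * A"
proof -
  have "L2_set d {..<N} \<le> L2_set (\<lambda>_. real N * A) {..<N}"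
    unfolding L2_set_def
    using assms by (intro real_sqrt_le_mono sum_mono) (auto simp: abs_le_square_iff[symmetric])
  also have "\<dots> = sqrt (real N) * (real N * A)"
    using assms(2) by (simp add: L2_set_def real_sqrt_mult)
  also have "\<dots> = real N powr (3/2) * A"
    using powr_mult_base[of "real N" "1/2"] by (simp add: powr_half_sqrt mult_ac)
  finally show ?thesis .
qed

definition gap :: "nat \<Rightarrow> (nat \<Rightarrow> nat) \<Rightarrow> real" where
  "gap N x = par N (\<lambda>i. real (x i)) 0 - real (Min (x ` {..<N}))"

lemma gap_cong:
  assumes "\<And>i. i < N \<Longrightarrow> x i = y i"
  shows "gap N x = gap N y"
proof -
  have "x ` {..<N} = y ` {..<N}"
    using assms by (intro image_cong) auto
  then show ?thesis
    using assms by (simp add: gap_def par_def)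
qed

lemma perp_shortest:
  assumes "i \<in> shortest N x"
  shows "i < N" "perp N (\<lambda>i. real (x i)) i = - gap N x"
proof -
  have i: "i < N" "\<And>j. j < N \<Longrightarrow> x i \<le> x j"
    using assms by (auto simp: shortest_def is_arg_min_linorder)
  then have "Min (x ` {..<N}) = x i"
    by (intro Min_eqI) auto
  then show "i < N" "perp N (\<lambda>i. real (x i)) i = - gap N x"
    using i by (auto simp: gap_def perp_def par_def)
qed

lemma perp_norm_le_gap:
  assumes "0 < N"
  shows "perp_norm N x \<le> real N * gap N x"
proof -
  let ?m = "Min (x ` {..<N})"
  have m: "?m \<le> x i" if "i < N" for i
    using that by (intro Min_le) auto
  have "perp_norm N x \<le> L2_set (\<lambda>i. real (x i) - real ?m) {..<N}"
    unfolding perp_norm_def by (rule L2_set_perp_le[OF assms])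
  also have "\<dots> \<le> (\<Sum>i<N. real (x i) - real ?m)"
    using m by (intro L2_set_le_sum) auto
  also have "\<dots> = real N * gap N x"
    using assms by (simp add: gap_def par_def sum_subtractf algebra_simps)
  finally show ?thesis .
qed

lemma abs_perp_le:
  assumes "i < N"
  shows "\<bar>perp N (\<lambda>i. real (x i)) i\<bar> \<le> perp_norm N x"
  unfolding perp_norm_def
  using member_le_L2_set[of "{..<N}" i "\<lambda>i. \<bar>perp N (\<lambda>i. real (x i)) i\<bar>"] assms
  by (simp add: L2_set_def)

lemma abs_gap_le:
  assumes "0 < N"
  shows "\<bar>gap N x\<bar> \<le> perp_norm N x"
proof -
  have "finite (x ` {..<N})" "x ` {..<N} \<noteq> {}"
    using assms by auto
  from Min_in[OF this] obtain i where i: "i < N" "x i = Min (x ` {..<N})"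
    by auto
  then have "perp N (\<lambda>i. real (x i)) i = - gap N x"
    by (simp add: gap_def perp_def par_def)
  then show ?thesis
    using abs_perp_le[OF i(1), of x] by simp
qed

text \<open>A smoothed version of \<^const>\<open>perp_norm\<close>: its drift stays of order \<open>\<delta>\<close> near the diagonal,
  where the drift bound for the norm itself, obtained from the drift of its square, blows up.\<close>

definition lyap :: "real \<Rightarrow> nat \<Rightarrow> (nat \<Rightarrow> nat) \<Rightarrow> real" where
  "lyap u N x = sqrt ((perp_norm N x)\<^sup>2 + u\<^sup>2)"

lemma lyap_cong: "(\<And>i. i < N \<Longrightarrow> x i = y i) \<Longrightarrow> lyap u N x = lyap u N y"
  using perp_norm_cong[of N x y] by (simp add: lyap_def)

lemma lyap_bounds:
  assumes "0 \<le> u"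
  shows "u \<le> lyap u N x" "perp_norm N x \<le> lyap u N x" "lyap u N x \<le> perp_norm N x + u"
proof -
  show "u \<le> lyap u N x" "perp_norm N x \<le> lyap u N x"
    unfolding lyap_def by (auto intro!: real_le_rsqrt)
  show "lyap u N x \<le> perp_norm N x + u"
    unfolding lyap_def using assms perp_norm_nonneg[of N x]
    by (intro real_le_lsqrt) (auto simp: power2_sum)
qed

lemma abs_lyap_diff_le: "\<bar>lyap u N x - lyap u N y\<bar> \<le> \<bar>perp_norm N x - perp_norm N y\<bar>"
proof -
  have "lyap u N x = norm (perp_norm N x, u)" for x
    by (simp add: lyap_def norm_Pair)
  then show ?thesis
    using norm_triangle_ineq3[of "(perp_norm N x, u)" "(perp_norm N y, u)"]
    by (simp add: norm_Pair)
qed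

lemma exp_le_quadratic:
  fixes x :: real
  assumes "x \<le> 1"
  shows "exp x \<le> 1 + x + x\<^sup>2"
proof (cases "0 \<le> x")
  case True
  then show ?thesis using assms by (rule exp_bound)
next
  case False
  define y where "y = - x"
  have y: "0 \<le> y" using False by (simp add: y_def)
  have nonneg: "0 \<le> 1 - y + y\<^sup>2"
    using zero_le_power2[of "y - 1/2"] by (simp add: power2_diff field_simps)
  have "1 \<le> 1 + (y\<^sup>2 + y ^ 3 + y ^ 4) / 2"
    using y by simp
  also have "\<dots> = (1 - y + y\<^sup>2) * (1 + y + y\<^sup>2 / 2)"
    by (simp add: field_simps power2_eq_square power3_eq_cube power4_eq_xxxx)
  also have "\<dots> \<le> (1 - y + y\<^sup>2) * exp y"
    using nonneg y by (intro mult_left_mono exp_lower_Taylor_quadratic)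
  finally have "exp (- y) \<le> 1 - y + y\<^sup>2"
    by (simp add: exp_minus divide_simps)
  then show ?thesis by (simp add: y_def)
qed

lemma exp_lyap_step:
  fixes \<theta> u B d Y Y' :: real
  assumes "0 < Y" "\<bar>Y' - Y\<bar> \<le> B" "Y'\<^sup>2 - Y\<^sup>2 \<le> d" "0 \<le> \<theta>" "\<theta> * B \<le> 1"
  shows "exp (\<theta> * Y') \<le> exp (\<theta> * Y) * (1 + \<theta> * (d / (2 * Y)) + \<theta>\<^sup>2 * B\<^sup>2)"
proof -
  let ?D = "Y' - Y"
  have "(Y' - Y)\<^sup>2 \<ge> 0" by simp
  then have "2 * Y * ?D \<le> d"
    using assms(3) by (simp add: power2_eq_square algebra_simps)
  then have D: "?D \<le> d / (2 * Y)"
    using assms(1) by (simp add: field_simps)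
  have "\<theta> * \<bar>?D\<bar> \<le> \<theta> * B"
    using assms by (intro mult_left_mono) auto
  then have le1: "\<bar>\<theta> * ?D\<bar> \<le> 1"
    using assms by (simp add: abs_mult)
  have sq: "?D\<^sup>2 \<le> B\<^sup>2"
    using assms(2) by (simp add: abs_le_square_iff[symmetric])
  have "exp (\<theta> * ?D) \<le> 1 + \<theta> * ?D + (\<theta> * ?D)\<^sup>2"
    using le1 by (intro exp_le_quadratic) auto
  also have "\<dots> \<le> 1 + \<theta> * (d / (2 * Y)) + \<theta>\<^sup>2 * B\<^sup>2"
    unfolding power_mult_distrib using D sq assms(4)
    by (intro add_mono mult_left_mono) auto
  finally have "exp (\<theta> * Y) * exp (\<theta> * ?D) \<le> exp (\<theta> * Y) * (1 + \<theta> * (d / (2 * Y)) + \<theta>\<^sup>2 * B\<^sup>2)"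
    by simp
  then show ?thesis
    by (simp add: exp_add[symmetric] algebra_simps)
qed

lemma drift_estimate:
  fixes Y Z u \<delta> \<theta> :: real
  assumes "0 < \<delta>" "0 < u" "u \<le> Y" "Y \<le> Z + u" "\<theta> * u = 1 / 4"
  shows "exp (\<theta> * Y) * (1 + \<theta> * (\<delta> * u / (2 * Y)) + \<theta>\<^sup>2 * (\<delta> * u)) - exp (\<theta> * Y) * \<theta> / Y * (\<delta> * Z)
    \<le> exp (\<theta> * Y) + \<theta> * \<delta> / 2 * (5 / 2 * exp (3 / 2) - exp (\<theta> * Y))"
proof -
  define E where "E = exp (\<theta> * Y)"
  have Y: "0 < Y" and \<theta>: "0 < \<theta>"
    using assms zero_less_mult_pos2[of \<theta> u] by auto
  have E: "E * (3 * u / (2 * Y) - 1 / 4) \<le> 5 / 4 * exp (3 / 2)"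
  proof (cases "Y \<le> 6 * u")
    case True
    then have "\<theta> * Y \<le> \<theta> * (6 * u)"
      using \<theta> by (intro mult_left_mono) auto
    then have "E \<le> exp (3 / 2)"
      using assms(5) by (simp add: E_def)
    moreover have "3 * u / (2 * Y) - 1 / 4 \<le> 5 / 4"
      using Y assms(3) by (simp add: field_simps)
    moreover have "0 \<le> 3 * u / (2 * Y) - 1 / 4"
      using Y True by (simp add: field_simps)
    ultimately have "E * (3 * u / (2 * Y) - 1 / 4) \<le> exp (3 / 2) * (5 / 4)"
      by (intro mult_mono) auto
    then show ?thesis by simp
  next
    case False
    then have "3 * u / (2 * Y) - 1 / 4 \<le> 0"
      using Y by (simp add: field_simps)
    then have "E * (3 * u / (2 * Y) - 1 / 4) \<le> 0"
      by (intro mult_nonneg_nonpos) (auto simp: E_def)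
    also have "0 \<le> 5 / 4 * exp (3 / 2 :: real)" by simp
    finally show ?thesis .
  qed
  have "Y / Y \<le> (Z + u) / Y"
    using Y assms(4) by (intro divide_right_mono) auto
  then have "u / (2 * Y) - Z / Y \<le> 3 * u / (2 * Y) - 1"
    using Y by (simp add: add_divide_distrib)
  then have "E * (u / (2 * Y) - Z / Y + 3 / 4) \<le> E * (3 * u / (2 * Y) - 1 / 4)"
    by (intro mult_left_mono) (auto simp: E_def)
  then have "E * (u / (2 * Y) - Z / Y + 3 / 4) \<le> 5 / 4 * exp (3 / 2)"
    using E by (rule order_trans)
  then have le: "\<theta> * \<delta> * (E * (u / (2 * Y) - Z / Y + 3 / 4)) \<le> \<theta> * \<delta> * (5 / 4 * exp (3 / 2))"
    by (rule mult_left_mono) (use \<theta> assms(1) in simp)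
  have sq: "\<theta>\<^sup>2 * (\<delta> * u) = \<theta> * \<delta> / 4"
    using assms(5) by (simp add: power2_eq_square mult_ac)
  have "E * (1 + \<theta> * (\<delta> * u / (2 * Y)) + \<theta>\<^sup>2 * (\<delta> * u)) - E * \<theta> / Y * (\<delta> * Z)
      = E + \<theta> * \<delta> * (E * (u / (2 * Y) - Z / Y + 3 / 4)) - \<theta> * \<delta> / 2 * E"
    unfolding sq by (simp add: algebra_simps)
  moreover have "\<theta> * \<delta> / 2 * (5 / 2 * exp (3 / 2) - E) = \<theta> * \<delta> * (5 / 4 * exp (3 / 2)) - \<theta> * \<delta> / 2 * E"
    by (simp add: algebra_simps)
  ultimately show ?thesis
    unfolding E_def[symmetric] using le by linarith
qed

lemma measurable_map_count_space:
  fixes g :: "'j \<Rightarrow> 'a \<Rightarrow> 'b::countable"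
  assumes "\<And>j. j \<in> set js \<Longrightarrow> g j \<in> M \<rightarrow>\<^sub>M count_space UNIV"
  shows "(\<lambda>\<omega>. map (\<lambda>j. g j \<omega>) js) \<in> M \<rightarrow>\<^sub>M count_space UNIV"
  using assms
proof (induction js)
  case (Cons j js)
  have "(\<lambda>\<omega>. g j \<omega> # map (\<lambda>j. g j \<omega>) js) \<in> M \<rightarrow>\<^sub>M count_space UNIV"
  proof (rule measurable_compose_countable[where f="\<lambda>x \<omega>. x # map (\<lambda>j. g j \<omega>) js"])
    show "(\<lambda>\<omega>. x # map (\<lambda>j. g j \<omega>) js) \<in> M \<rightarrow>\<^sub>M count_space UNIV" for x
      by (rule measurable_compose[OF Cons.IH]) (use Cons.prems in auto)
  qed (use Cons.prems in auto)
  then show ?case by simp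
qed simp

lemma (in prob_space) indep_var_countable:
  fixes X T :: "'a \<Rightarrow> 'b::countable"
  assumes [measurable]: "X \<in> M \<rightarrow>\<^sub>M count_space UNIV" "T \<in> M \<rightarrow>\<^sub>M count_space UNIV"
    and prod: "\<And>x t. prob {\<omega> \<in> space M. X \<omega> = x \<and> T \<omega> = t}
      = prob {\<omega> \<in> space M. X \<omega> = x} * prob {\<omega> \<in> space M. T \<omega> = t}"
  shows "indep_var (count_space UNIV) X (count_space UNIV) T"
proof -
  have pair: "count_space UNIV \<Otimes>\<^sub>M count_space UNIV = (count_space UNIV :: ('b \<times> 'b) measure)"
    by (simp add: pair_measure_countable)
  interpret D: prob_space "distr M (count_space UNIV) T"
    by (rule prob_space_distr) simp
  have "distr M (count_space UNIV) X \<Otimes>\<^sub>M distr M (count_space UNIV) T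
    = distr M (count_space UNIV \<Otimes>\<^sub>M count_space UNIV) (\<lambda>\<omega>. (X \<omega>, T \<omega>))"
  proof (rule measure_eqI_countable)
    show "sets (distr M (count_space UNIV) X \<Otimes>\<^sub>M distr M (count_space UNIV) T) = Pow UNIV"
      using sets_pair_measure_cong[OF sets_distr sets_distr, of M "count_space UNIV" X M "count_space UNIV" T]
      unfolding pair by simp
    show "sets (distr M (count_space UNIV \<Otimes>\<^sub>M count_space UNIV) (\<lambda>\<omega>. (X \<omega>, T \<omega>))) = Pow UNIV"
      using pair by simp
  next
    fix z :: "'b \<times> 'b"
    obtain x t where z: "z = (x, t)" by (cases z)
    have "emeasure (distr M (count_space UNIV) X \<Otimes>\<^sub>M distr M (count_space UNIV) T) ({x} \<times> {t})
       = emeasure (distr M (count_space UNIV) X) {x} * emeasure (distr M (count_space UNIV) T) {t}"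
      by (rule D.emeasure_pair_measure_Times) auto
    also have "\<dots> = ennreal (prob {\<omega> \<in> space M. X \<omega> = x}) * ennreal (prob {\<omega> \<in> space M. T \<omega> = t})"
      by (auto simp: emeasure_distr emeasure_eq_measure vimage_def Int_def conj_commute)
    also have "\<dots> = ennreal (prob {\<omega> \<in> space M. X \<omega> = x \<and> T \<omega> = t})"
      by (simp add: prod ennreal_mult)
    also have "\<dots> = emeasure (distr M (count_space UNIV \<Otimes>\<^sub>M count_space UNIV) (\<lambda>\<omega>. (X \<omega>, T \<omega>))) {(x, t)}"
      by (auto simp: emeasure_distr emeasure_eq_measure pair vimage_def Int_def conj_commute
          intro!: arg_cong[where f=prob] arg_cong[where f=ennreal])
    finally show "emeasure (distr M (count_space UNIV) X \<Otimes>\<^sub>M distr M (count_space UNIV) T) {z}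
      = emeasure (distr M (count_space UNIV \<Otimes>\<^sub>M count_space UNIV) (\<lambda>\<omega>. (X \<omega>, T \<omega>))) {z}"
      by (simp add: z)
  qed auto
  then show ?thesis
    by (subst indep_var_distribution_eq) auto
qed

lemma (in prob_space) expectation_cong_distr:
  fixes T T' :: "'a \<Rightarrow> nat"
  assumes [measurable]: "T \<in> M \<rightarrow>\<^sub>M count_space UNIV" "T' \<in> M \<rightarrow>\<^sub>M count_space UNIV"
    and eq: "distr M (count_space UNIV) T = distr M (count_space UNIV) T'"
  shows "expectation (\<lambda>\<omega>. real (T \<omega>)) = expectation (\<lambda>\<omega>. real (T' \<omega>))"
    and "(AE \<omega> in M. P (T \<omega>)) \<longleftrightarrow> (AE \<omega> in M. P (T' \<omega>))"
proof -
  have "expectation (\<lambda>\<omega>. real (T \<omega>)) = integral\<^sup>L (distr M (count_space UNIV) T) real"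
    by (rule integral_distr[symmetric]) auto
  also have "\<dots> = expectation (\<lambda>\<omega>. real (T' \<omega>))"
    unfolding eq by (rule integral_distr) auto
  finally show "expectation (\<lambda>\<omega>. real (T \<omega>)) = expectation (\<lambda>\<omega>. real (T' \<omega>))" .
  have "(AE \<omega> in M. P (T \<omega>)) \<longleftrightarrow> (AE m in distr M (count_space UNIV) T. P m)"
    by (rule AE_distr_iff[symmetric]) auto
  also have "\<dots> \<longleftrightarrow> (AE \<omega> in M. P (T' \<omega>))"
    unfolding eq by (rule AE_distr_iff) auto
  finally show "(AE \<omega> in M. P (T \<omega>)) \<longleftrightarrow> (AE \<omega> in M. P (T' \<omega>))" .
qed

lemma measurable_finite_coordinates:
  fixes F :: "(nat \<Rightarrow> 'b::countable) \<Rightarrow> real"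
  assumes x: "\<And>i. i < N \<Longrightarrow> (\<lambda>\<omega>. x \<omega> i) \<in> M \<rightarrow>\<^sub>M count_space UNIV"
    and F: "\<And>x y. (\<And>i. i < N \<Longrightarrow> x i = y i) \<Longrightarrow> F x = F y"
  shows "(\<lambda>\<omega>. F (x \<omega>)) \<in> borel_measurable M"
proof -
  have "F (x \<omega>) = F (\<lambda>j. map (\<lambda>i. x \<omega> i) [0..<N] ! j)" for \<omega>
    by (rule F) simp
  moreover have "(\<lambda>\<omega>. map (\<lambda>i. x \<omega> i) [0..<N]) \<in> M \<rightarrow>\<^sub>M count_space UNIV"
    by (rule measurable_map_count_space) (use x in auto)
  then have "(\<lambda>\<omega>. F (\<lambda>j. map (\<lambda>i. x \<omega> i) [0..<N] ! j)) \<in> borel_measurable M"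
    by (rule measurable_compose) simp
  ultimately show ?thesis by simp
qed

lemma continuous_on_finite_coordinates:
  fixes F :: "(nat \<Rightarrow> 'b::discrete_topology) \<Rightarrow> 'c::topological_space"
  assumes F: "\<And>x y. (\<And>i. i < N \<Longrightarrow> x i = y i) \<Longrightarrow> F x = F y"
  shows "continuous_on UNIV F"
  unfolding continuous_on_open_vimage[OF open_UNIV]
proof (intro allI impI)
  fix S :: "'c set"
  let ?V = "\<lambda>x. \<Inter>i\<in>{..<N}. (\<lambda>y. y i) -` {x i}"
  have "open ((\<lambda>y. y i) -` {x i})" for x :: "nat \<Rightarrow> 'b" and i
    by (rule open_vimage[OF discrete_topology_class.open_discrete continuous_on_product_coordinates])
  then have "open (\<Union>x\<in>F -` S. ?V x)"
    by (intro open_UN ballI open_INT) auto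
  moreover have "(\<Union>x\<in>F -` S. ?V x) = F -` S"
  proof
    show "(\<Union>x\<in>F -` S. ?V x) \<subseteq> F -` S"
    proof
      fix y assume "y \<in> (\<Union>x\<in>F -` S. ?V x)"
      then obtain x where "F x \<in> S" "\<And>i. i < N \<Longrightarrow> y i = x i" by auto
      then show "y \<in> F -` S" using F[of y x] by simp
    qed
  qed auto
  ultimately show "open (F -` S \<inter> UNIV)" by simp
qed

lemma steady_state_tendsto:
  fixes F :: "(nat \<Rightarrow> nat) \<Rightarrow> real"
  assumes ss: "steady_state N M q M' qbar"
    and F: "\<And>x y. (\<And>i. i < N \<Longrightarrow> x i = y i) \<Longrightarrow> F x = F y"
    and c: "\<And>x. \<bar>F x\<bar> \<le> c"
  shows "(\<lambda>k. \<integral>\<omega>. F (q k \<omega>) \<partial>M) \<longlonglongrightarrow> (\<integral>\<omega>. F (qbar \<omega>) \<partial>M')"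
proof -
  have "F (restrict x {..<N}) = F x" for x
    by (rule F) simp
  moreover have "continuous_on UNIV F"
    by (rule continuous_on_finite_coordinates[OF F])
  moreover have "bounded (range F)"
    unfolding bounded_iff using c by auto
  ultimately show ?thesis
    using ss unfolding steady_state_def converges_in_distribution_def by (auto dest!: spec[of _ F])
qed

context jsq_system
begin

lemma N_pos: "0 < N"
  using not_empty route_shortest perp_shortest(1) by (metis all_not_in_conv less_nat_zero_code not_gr_zero)

lemma measurable_a[measurable]: "a k \<in> M \<rightarrow>\<^sub>M count_space UNIV"
  using indep_a_s unfolding indep_vars_def by force

lemma measurable_s[measurable]: "i < N \<Longrightarrow> s i k \<in> M \<rightarrow>\<^sub>M count_space UNIV"
  using indep_a_s unfolding indep_vars_def by force

text \<open>Lists make the history and the data of a slot values of one countable type, on which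
  independence can be read off from elementary events.\<close>

definition history :: "nat \<Rightarrow> 'w \<Rightarrow> nat list list" where
  "history k \<omega> = map (\<lambda>l. map (q l \<omega>) [0..<N]) [0..<Suc k]"

definition slot :: "nat \<Rightarrow> 'w \<Rightarrow> nat list list" where
  "slot k \<omega> = [a k \<omega> # map (\<lambda>j. s j k \<omega>) [0..<N]]"

lemma measurable_history: "history k \<in> M \<rightarrow>\<^sub>M count_space UNIV"
  unfolding history_def
  by (intro measurable_map_count_space) (auto intro: measurable_q)

lemma measurable_slot: "slot k \<in> M \<rightarrow>\<^sub>M count_space UNIV"
proof -
  have "(\<lambda>\<omega>. [a k \<omega> # map (\<lambda>j. s j k \<omega>) [0..<N]]) \<in> M \<rightarrow>\<^sub>M count_space UNIV"
  proof (rule measurable_compose_countable[where f="\<lambda>m \<omega>. [m # map (\<lambda>j. s j k \<omega>) [0..<N]]"])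
    show "(\<lambda>\<omega>. [m # map (\<lambda>j. s j k \<omega>) [0..<N]]) \<in> M \<rightarrow>\<^sub>M count_space UNIV" for m
      by (rule measurable_compose[OF measurable_map_count_space[of "[0..<N]" "\<lambda>j. s j k"]]) auto
  qed auto
  then show ?thesis by (simp add: slot_def[abs_def])
qed

lemma history_eq_iff: "history k \<omega> = history k \<omega>' \<longleftrightarrow> (\<forall>l\<le>k. \<forall>j<N. q l \<omega> j = q l \<omega>' j)"
  by (auto simp: history_def list_eq_iff_nth_eq less_Suc_eq_le simp del: upt_Suc)

lemma slot_eq_iff: "slot k \<omega> = slot k \<omega>' \<longleftrightarrow> a k \<omega> = a k \<omega>' \<and> (\<forall>j<N. s j k \<omega> = s j k \<omega>')"
  by (auto simp: slot_def)

lemma indep_history_slot: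
  "indep_var (count_space UNIV) (history k) (count_space UNIV) (slot k)"
proof (rule indep_var_countable[OF measurable_history measurable_slot])
  fix x t :: "nat list list"
  show "prob {\<omega> \<in> space M. history k \<omega> = x \<and> slot k \<omega> = t}
      = prob {\<omega> \<in> space M. history k \<omega> = x} * prob {\<omega> \<in> space M. slot k \<omega> = t}"
  proof (cases "(\<exists>\<omega>. history k \<omega> = x) \<and> (\<exists>\<omega>. slot k \<omega> = t)")
    case True
    then obtain \<omega>1 \<omega>2 where \<omega>: "history k \<omega>1 = x" "slot k \<omega>2 = t"
      by blast
    have "\<And>\<omega>. history k \<omega> = x \<longleftrightarrow> (\<forall>l\<le>k. \<forall>j<N. q l \<omega> j = q l \<omega>1 j)"
      "\<And>\<omega>. slot k \<omega> = t \<longleftrightarrow> a k \<omega> = a k \<omega>2 \<and> (\<forall>j<N. s j k \<omega> = s j k \<omega>2)"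
      by (simp_all add: history_eq_iff slot_eq_iff flip: \<omega>)
    then show ?thesis
      using indep_history[of k "a k \<omega>2" "\<lambda>j. s j k \<omega>2" "\<lambda>l. q l \<omega>1"]
      by (simp add: conj_ac mult.commute)
  next
    case False
    then have "\<And>\<omega>. history k \<omega> \<noteq> x \<or> slot k \<omega> \<noteq> t" "(\<forall>\<omega>. history k \<omega> \<noteq> x) \<or> (\<forall>\<omega>. slot k \<omega> \<noteq> t)"
      by blast+
    then show ?thesis by auto
  qed
qed

lemma expectation_state_mult_slot:
  fixes F :: "(nat \<Rightarrow> nat) \<Rightarrow> real" and G :: "nat list list \<Rightarrow> real"
  assumes F: "\<And>x y. (\<And>i. i < N \<Longrightarrow> x i = y i) \<Longrightarrow> F x = F y"
    and int: "integrable M (\<lambda>\<omega>. F (q k \<omega>))" "integrable M (\<lambda>\<omega>. G (slot k \<omega>))"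
  shows "integrable M (\<lambda>\<omega>. F (q k \<omega>) * G (slot k \<omega>))"
    and "expectation (\<lambda>\<omega>. F (q k \<omega>) * G (slot k \<omega>))
      = expectation (\<lambda>\<omega>. F (q k \<omega>)) * expectation (\<lambda>\<omega>. G (slot k \<omega>))"
proof -
  have eq: "F (q k \<omega>) = F (\<lambda>j. history k \<omega> ! k ! j)" for \<omega>
    by (rule F) (simp add: history_def del: upt_Suc)
  have "indep_var borel ((\<lambda>h. F (\<lambda>j. h ! k ! j)) \<circ> history k) borel (G \<circ> slot k)"
    by (rule indep_var_compose[OF indep_history_slot]) auto
  then have ind: "indep_var borel (\<lambda>\<omega>. F (q k \<omega>)) borel (\<lambda>\<omega>. G (slot k \<omega>))"
    by (simp add: eq comp_def)
  show "integrable M (\<lambda>\<omega>. F (q k \<omega>) * G (slot k \<omega>))"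
    "expectation (\<lambda>\<omega>. F (q k \<omega>) * G (slot k \<omega>))
      = expectation (\<lambda>\<omega>. F (q k \<omega>)) * expectation (\<lambda>\<omega>. G (slot k \<omega>))"
    using indep_var_integrable[OF ind int] indep_var_lebesgue_integral[OF ind int] by auto
qed

lemma arrivals:
  shows "expectation (\<lambda>\<omega>. real (a k \<omega>)) = real N * (1 - real N powr (-\<alpha>))"
    and "AE \<omega> in M. real (a k \<omega>) \<le> real N * Amax"
    and "integrable M (\<lambda>\<omega>. real (a k \<omega>))"
proof -
  show "expectation (\<lambda>\<omega>. real (a k \<omega>)) = real N * (1 - real N powr (-\<alpha>))"
    using expectation_cong_distr(1)[OF _ _ ident_a[of k]] mean_a by simp
  show AE: "AE \<omega> in M. real (a k \<omega>) \<le> real N * Amax"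
    using expectation_cong_distr(2)[OF _ _ ident_a[of k], of "\<lambda>m. real m \<le> real N * Amax"] bound_a
    by simp
  show "integrable M (\<lambda>\<omega>. real (a k \<omega>))"
    by (rule integrable_const_bound[where B="real N * Amax"]) (use AE in auto)
qed

lemma services:
  assumes i[simp]: "i < N"
  shows "expectation (\<lambda>\<omega>. real (s i k \<omega>)) = 1"
    and "AE \<omega> in M. real (s i k \<omega>) \<le> Smax"
    and "integrable M (\<lambda>\<omega>. real (s i k \<omega>))"
proof -
  note [measurable] = measurable_s[OF i]
  show "expectation (\<lambda>\<omega>. real (s i k \<omega>)) = 1"
    using expectation_cong_distr(1)[OF _ _ ident_s[OF i, of k]] mean_s[OF i] by simp
  show AE: "AE \<omega> in M. real (s i k \<omega>) \<le> Smax"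
    using expectation_cong_distr(2)[OF _ _ ident_s[OF i, of k], of "\<lambda>m. real m \<le> Smax"] bound_s[OF i]
    by simp
  show "integrable M (\<lambda>\<omega>. real (s i k \<omega>))"
    by (rule integrable_const_bound[where B="Smax"]) (use AE in auto)
qed

lemma perp_norm_step:
  assumes \<omega>: "\<omega> \<in> space M" and A: "0 \<le> A"
    and a: "real (a k \<omega>) \<le> real N * A" and s: "\<And>i. i < N \<Longrightarrow> real (s i k \<omega>) \<le> real N * A"
  defines "x \<equiv> q k \<omega>" and "y \<equiv> q (Suc k) \<omega>" and "B \<equiv> real N powr (3/2) * A"
  shows "\<bar>perp_norm N y - perp_norm N x\<bar> \<le> B"
    and "(perp_norm N y)\<^sup>2 - (perp_norm N x)\<^sup>2
      \<le> B\<^sup>2 - 2 * (gap N x * real (a k \<omega>)) - 2 * (\<Sum>i<N. perp N (\<lambda>i. real (x i)) i * real (s i k \<omega>))"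
proof -
  define i0 where "i0 = istar k \<omega>"
  define d where "d i = (if i = i0 then real (a k \<omega>) else 0) - real (s i k \<omega>)" for i
  have i0: "i0 < N" "perp N (\<lambda>i. real (x i)) i0 = - gap N x"
    using perp_shortest[OF route_shortest[OF \<omega>, of k]] by (auto simp: i0_def x_def)
  have y: "real (y i) = max (real (x i) + d i) 0" if "i < N" for i
  proof -
    have "real_of_int (int (y i)) = real_of_int (max (int (x i) + int (if i = i0 then a k \<omega> else 0) - int (s i k \<omega>)) 0)"
      unfolding y_def x_def i0_def using dynamics[OF that \<omega>] by simp
    then show ?thesis by (auto simp: d_def of_int_max)
  qed
  have d: "\<bar>d i\<bar> \<le> real N * A" if "i < N" for i
    using a s[OF that] A by (auto simp: d_def abs_le_iff intro: order_trans add_increasing)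
  have dB: "L2_set d {..<N} \<le> B"
    unfolding B_def by (rule L2_set_le_bound) (use d A in auto)
  have "\<bar>perp_norm N y - perp_norm N x\<bar> \<le> L2_set (\<lambda>i. real (y i) - real (x i)) {..<N}"
    unfolding perp_norm_def by (rule L2_set_perp_diff_le[OF N_pos])
  also have "\<dots> \<le> B"
    unfolding B_def
  proof (rule L2_set_le_bound)
    fix i assume i: "i < N"
    have "\<bar>real (y i) - real (x i)\<bar> \<le> \<bar>d i\<bar>"
      using y[OF i] by (auto simp: max_def)
    then show "\<bar>real (y i) - real (x i)\<bar> \<le> real N * A"
      using d[OF i] by simp
  qed fact
  finally show "\<bar>perp_norm N y - perp_norm N x\<bar> \<le> B" .
  have "perp_norm N y = L2_set (perp N (\<lambda>i. max (real (x i) + d i) 0)) {..<N}"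
    unfolding perp_norm_def by (rule L2_set_cong) (auto intro!: perp_cong simp: y)
  also have "\<dots> \<le> L2_set (perp N (\<lambda>i. real (x i) + d i)) {..<N}"
    by (rule L2_set_perp_max_le[OF N_pos])
  finally have "(perp_norm N y)\<^sup>2 \<le> (L2_set (perp N (\<lambda>i. real (x i) + d i)) {..<N})\<^sup>2"
    by (simp add: perp_norm_nonneg power_mono)
  also have "\<dots> = (perp_norm N x)\<^sup>2 + 2 * (\<Sum>i<N. perp N (\<lambda>i. real (x i)) i * d i) + (L2_set (perp N d) {..<N})\<^sup>2"
    unfolding perp_norm_def by (rule L2_set_perp_add_square[OF N_pos])
  also have "(L2_set (perp N d) {..<N})\<^sup>2 \<le> B\<^sup>2"
    using L2_set_perp_le[OF N_pos, of d 0] dB by (intro power_mono) auto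
  also have "(\<Sum>i<N. perp N (\<lambda>i. real (x i)) i * d i)
    = (\<Sum>i<N. if i = i0 then perp N (\<lambda>i. real (x i)) i * real (a k \<omega>) else 0) -
      (\<Sum>i<N. perp N (\<lambda>i. real (x i)) i * real (s i k \<omega>))"
    unfolding sum_subtractf[symmetric] by (rule sum.cong) (auto simp: d_def right_diff_distrib)
  also have "\<dots> = - gap N x * real (a k \<omega>) - (\<Sum>i<N. perp N (\<lambda>i. real (x i)) i * real (s i k \<omega>))"
    using i0 by simp
  finally show "(perp_norm N y)\<^sup>2 - (perp_norm N x)\<^sup>2
      \<le> B\<^sup>2 - 2 * (gap N x * real (a k \<omega>)) - 2 * (\<Sum>i<N. perp N (\<lambda>i. real (x i)) i * real (s i k \<omega>))"
    by simp
qed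

lemma heavy_traffic_le_Amax: "1 - real N powr (-\<alpha>) \<le> Amax"
proof -
  have "expectation (\<lambda>\<omega>. real (a 1 \<omega>)) \<le> real N * Amax"
    using arrivals(2,3)[of 1] by (intro integral_le_const) auto
  then have "real N * (1 - real N powr (-\<alpha>)) \<le> real N * Amax"
    unfolding mean_a .
  then show ?thesis
    using N_pos by (simp only: mult_le_cancel_left_pos of_nat_0_less_iff)
qed

lemma drift:
  assumes \<delta>: "0 < \<delta>" "\<delta> \<le> 1 - real N powr (-\<alpha>)" and A: "Amax \<le> A" "Smax \<le> real N * A"
  defines "B \<equiv> real N powr (3/2) * A"
  defines "u \<equiv> B\<^sup>2 / \<delta>" and "\<theta> \<equiv> \<delta> / (4 * B\<^sup>2)"
  shows "expectation (\<lambda>\<omega>. exp (\<theta> * min (lyap u N (q (Suc k) \<omega>)) L))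
    \<le> expectation (\<lambda>\<omega>. exp (\<theta> * min (lyap u N (q k \<omega>)) L)
        + (if lyap u N (q k \<omega>) \<le> L then \<theta> * \<delta> / 2 * (5 / 2 * exp (3 / 2) - exp (\<theta> * lyap u N (q k \<omega>))) else 0))"
proof -
  have \<delta>A: "\<delta> \<le> A"
    using \<delta>(2) A(1) heavy_traffic_le_Amax by linarith
  have "A \<le> B"
    unfolding B_def using ge_one_powr_ge_zero[of "real N" "3/2"] N_pos \<delta>A \<delta>(1)
    by (simp add: mult_le_cancel_right1)
  then have B: "0 < B" "\<delta> \<le> B"
    using \<delta>A \<delta>(1) by auto
  have u: "0 < u" and \<theta>: "0 < \<theta>" and \<theta>u: "\<theta> * u = 1 / 4" and B2: "B\<^sup>2 = \<delta> * u"
    using B \<delta> by (auto simp: u_def \<theta>_def)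
  have \<theta>B: "\<theta> * B \<le> 1"
    using B \<delta> by (simp add: \<theta>_def power2_eq_square field_simps)
  let ?Y = "lyap u N" and ?p = "\<lambda>x. perp N (\<lambda>i. real (x i))"
  define w where "w x = (if ?Y x \<le> L then exp (\<theta> * ?Y x) * \<theta> / ?Y x else 0)" for x
  define H where "H x = (if ?Y x \<le> L then exp (\<theta> * ?Y x) * (1 + \<theta> * (B\<^sup>2 / (2 * ?Y x)) + \<theta>\<^sup>2 * B\<^sup>2)
     else exp (\<theta> * L))" for x
  have Y: "u \<le> ?Y x" "0 < ?Y x" "perp_norm N x \<le> ?Y x" "?Y x \<le> perp_norm N x + u" for x
    using lyap_bounds[of u N x] u by auto
  have w0: "0 \<le> w x" for x
    using Y(2)[of x] \<theta> by (simp add: w_def)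
  have w_le: "\<bar>w x * c\<bar> \<le> \<theta> * exp (\<theta> * L)" if "\<bar>c\<bar> \<le> perp_norm N x" for x c
  proof (cases "?Y x \<le> L")
    case True
    have "\<bar>c\<bar> / ?Y x \<le> 1"
      using that Y[of x] by simp
    then have "exp (\<theta> * ?Y x) * \<theta> * (\<bar>c\<bar> / ?Y x) \<le> exp (\<theta> * L) * \<theta> * 1"
      using True \<theta> Y(2)[of x] by (intro mult_mono) auto
    then show ?thesis
      using True \<theta> Y(2)[of x] by (simp add: w_def abs_mult mult_ac)
  next
    case False
    then show ?thesis using \<theta> by (simp add: w_def)
  qed
  have w_cong: "w x = w y" if "\<And>i. i < N \<Longrightarrow> x i = y i" for x y
    using lyap_cong[of N x y u] that by (simp add: w_def)
  have H_cong: "H x = H y" if "\<And>i. i < N \<Longrightarrow> x i = y i" for x y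
    using lyap_cong[of N x y u] that by (simp add: H_def)
  have int_state: "integrable M (\<lambda>\<omega>. F (q j \<omega>))"
    if "\<And>x y. (\<And>i. i < N \<Longrightarrow> x i = y i) \<Longrightarrow> F x = F y" "\<And>x. \<bar>F x\<bar> \<le> c"
    for F :: "(nat \<Rightarrow> nat) \<Rightarrow> real" and c j
    using measurable_finite_coordinates[where N=N and x="q j", OF measurable_q that(1)]
    by (rule integrable_const_bound[where B=c, rotated]) (use that(2) in auto)
  have cong0: "w x * gap N x = w y * gap N y" if "\<And>i. i < N \<Longrightarrow> x i = y i" for x y
    using that w_cong[of x y] gap_cong[of N x y] by simp
  have congi: "w x * ?p x i = w y * ?p y i" if "\<And>i. i < N \<Longrightarrow> x i = y i" "i < N" for x y i
    using that w_cong[of x y] perp_cong[of N "\<lambda>i. real (x i)" "\<lambda>i. real (y i)" i] by simp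
  have H_le: "\<bar>H x\<bar> \<le> exp (\<theta> * L) * (1 + \<theta> * (B\<^sup>2 / (2 * u)) + \<theta>\<^sup>2 * B\<^sup>2)" for x
  proof -
    have "1 \<le> 1 + \<theta> * (B\<^sup>2 / (2 * u)) + \<theta>\<^sup>2 * B\<^sup>2"
      using \<theta> u by simp
    then have *: "exp (\<theta> * L) * 1 \<le> exp (\<theta> * L) * (1 + \<theta> * (B\<^sup>2 / (2 * u)) + \<theta>\<^sup>2 * B\<^sup>2)"
      by (intro mult_left_mono) auto
    have "B\<^sup>2 / (2 * ?Y x) \<le> B\<^sup>2 / (2 * u)"
      using Y[of x] u by (intro divide_left_mono) auto
    then have "exp (\<theta> * ?Y x) * (1 + \<theta> * (B\<^sup>2 / (2 * ?Y x)) + \<theta>\<^sup>2 * B\<^sup>2)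
      \<le> exp (\<theta> * L) * (1 + \<theta> * (B\<^sup>2 / (2 * u)) + \<theta>\<^sup>2 * B\<^sup>2)" if "?Y x \<le> L"
      using that \<theta> Y(2)[of x] by (intro mult_mono add_mono mult_left_mono) auto
    then show ?thesis
      using * \<theta> Y(2)[of x] by (auto simp: H_def abs_mult)
  qed
  have int_H: "integrable M (\<lambda>\<omega>. H (q k \<omega>))"
    by (rule int_state[OF H_cong H_le])
  have int_gap: "integrable M (\<lambda>\<omega>. w (q k \<omega>) * gap N (q k \<omega>))"
    by (rule int_state[OF cong0 w_le[OF abs_gap_le[OF N_pos]]])
  have int_perp: "integrable M (\<lambda>\<omega>. w (q k \<omega>) * ?p (q k \<omega>) i)" if "i < N" for i
    by (rule int_state[OF congi w_le[OF abs_perp_le]]) (use that in auto)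
  have a: "real (a k \<omega>) = real (hd (hd (slot k \<omega>)))" for \<omega>
    by (simp add: slot_def)
  have s: "real (s i k \<omega>) = real (hd (slot k \<omega>) ! Suc i)" if "i < N" for i \<omega>
    using that by (simp add: slot_def)
  have gap_a: "integrable M (\<lambda>\<omega>. w (q k \<omega>) * gap N (q k \<omega>) * real (a k \<omega>))"
    "expectation (\<lambda>\<omega>. w (q k \<omega>) * gap N (q k \<omega>) * real (a k \<omega>))
      = expectation (\<lambda>\<omega>. w (q k \<omega>) * gap N (q k \<omega>)) * (real N * (1 - real N powr (-\<alpha>)))"
    using expectation_state_mult_slot[where F="\<lambda>x. w x * gap N x" and k=k and G="\<lambda>t. real (hd (hd t))",
        OF cong0 int_gap] arrivals(1,3)[of k]
    by (simp_all add: a)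
  have perp_s: "integrable M (\<lambda>\<omega>. w (q k \<omega>) * ?p (q k \<omega>) i * real (s i k \<omega>))"
    "expectation (\<lambda>\<omega>. w (q k \<omega>) * ?p (q k \<omega>) i * real (s i k \<omega>))
      = expectation (\<lambda>\<omega>. w (q k \<omega>) * ?p (q k \<omega>) i)" if "i < N" for i
    using expectation_state_mult_slot[where F="\<lambda>x. w x * ?p x i" and k=k and G="\<lambda>t. real (hd t ! Suc i)",
        OF congi[OF _ that] int_perp[OF that]] services(1,3)[OF that, of k] that
    by (simp_all add: s)
  have AE_s: "AE \<omega> in M. \<forall>i\<in>{..<N}. real (s i k \<omega>) \<le> Smax"
    using services(2) by (intro AE_finite_allI) auto
  have ident: "E * (1 + \<theta> * ((b - 2 * g - 2 * S) / (2 * y)) + c)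
      = E * (1 + \<theta> * (b / (2 * y)) + c) - E * \<theta> / y * g - E * \<theta> / y * S" for E b g S y c :: real
  proof -
    have *: "(b - 2 * g - 2 * S) / (2 * y) = b / (2 * y) - g / y - S / y"
      by (simp add: diff_divide_distrib)
    show ?thesis unfolding * by (simp add: algebra_simps)
  qed
  have step: "AE \<omega> in M. exp (\<theta> * min (?Y (q (Suc k) \<omega>)) L) \<le> H (q k \<omega>)
      - w (q k \<omega>) * gap N (q k \<omega>) * real (a k \<omega>)
      - (\<Sum>i<N. w (q k \<omega>) * ?p (q k \<omega>) i * real (s i k \<omega>))"
    using arrivals(2)[of k] AE_s AE_space
  proof eventually_elim
    case (elim \<omega>)
    let ?x = "q k \<omega>" and ?y = "q (Suc k) \<omega>"
    show ?case
    proof (cases "?Y ?x \<le> L")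
      case True
      let ?d = "B\<^sup>2 - 2 * (gap N ?x * real (a k \<omega>)) - 2 * (\<Sum>i<N. ?p ?x i * real (s i k \<omega>))"
      have "real (a k \<omega>) \<le> real N * A"
        using elim(1) mult_left_mono[OF A(1), of "real N"] by simp
      moreover have "real (s i k \<omega>) \<le> real N * A" if "i < N" for i
        using bspec[OF elim(2), of i] A(2) that by simp
      ultimately have 1: "\<bar>perp_norm N ?y - perp_norm N ?x\<bar> \<le> B"
        and 2: "(perp_norm N ?y)\<^sup>2 - (perp_norm N ?x)\<^sup>2 \<le> ?d"
        using perp_norm_step[OF elim(3), of A k] \<delta>A \<delta>(1) by (auto simp: B_def)
      have "(?Y ?y)\<^sup>2 - (?Y ?x)\<^sup>2 \<le> ?d"
        using 2 by (simp add: lyap_def)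
      then have "exp (\<theta> * ?Y ?y) \<le> exp (\<theta> * ?Y ?x) * (1 + \<theta> * (?d / (2 * ?Y ?x)) + \<theta>\<^sup>2 * B\<^sup>2)"
        using Y(2) abs_lyap_diff_le[of u N ?y ?x] 1 \<theta> \<theta>B by (intro exp_lyap_step) auto
      also have "\<dots> = H ?x - w ?x * (gap N ?x * real (a k \<omega>)) - w ?x * (\<Sum>i<N. ?p ?x i * real (s i k \<omega>))"
        unfolding H_def w_def if_P[OF True] by (rule ident)
      finally have "exp (\<theta> * ?Y ?y) \<le> H ?x - w ?x * gap N ?x * real (a k \<omega>) - (\<Sum>i<N. w ?x * ?p ?x i * real (s i k \<omega>))"
        by (simp add: sum_distrib_left mult.assoc)
      moreover have "exp (\<theta> * min (?Y ?y) L) \<le> exp (\<theta> * ?Y ?y)"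
        using \<theta> by simp
      ultimately show ?thesis by linarith
    next
      case False
      then show ?thesis using \<theta> by (simp add: w_def H_def)
    qed
  qed
  have int_min: "integrable M (\<lambda>\<omega>. exp (\<theta> * min (?Y (q j \<omega>)) L))" for j
  proof (rule int_state[of "\<lambda>x. exp (\<theta> * min (?Y x) L)" "exp (\<theta> * L)"])
    show "exp (\<theta> * min (?Y x) L) = exp (\<theta> * min (?Y y) L)" if "\<And>i. i < N \<Longrightarrow> x i = y i" for x y
      using lyap_cong[of N x y u] that by simp
  qed (use \<theta> in simp)
  have expand: "integrable M (\<lambda>\<omega>. f \<omega> - g \<omega> - (\<Sum>i<N. h i \<omega>))"
    "expectation (\<lambda>\<omega>. f \<omega> - g \<omega> - (\<Sum>i<N. h i \<omega>))
      = expectation f - expectation g - (\<Sum>i<N. expectation (h i))"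
    if "integrable M f" "integrable M g" "\<And>i. i < N \<Longrightarrow> integrable M (h i)"
    for f g :: "'w \<Rightarrow> real" and h :: "nat \<Rightarrow> 'w \<Rightarrow> real"
  proof -
    have fg: "integrable M (\<lambda>\<omega>. f \<omega> - g \<omega>)"
      using that(1,2) by (rule Bochner_Integration.integrable_diff)
    have sum: "integrable M (\<lambda>\<omega>. \<Sum>i<N. h i \<omega>)"
      by (rule Bochner_Integration.integrable_sum) (use that(3) in simp)
    show "integrable M (\<lambda>\<omega>. f \<omega> - g \<omega> - (\<Sum>i<N. h i \<omega>))"
      using fg sum by (rule Bochner_Integration.integrable_diff)
    have "expectation (\<lambda>\<omega>. \<Sum>i<N. h i \<omega>) = (\<Sum>i<N. expectation (h i))"
      by (rule Bochner_Integration.integral_sum) (use that(3) in simp)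
    then show "expectation (\<lambda>\<omega>. f \<omega> - g \<omega> - (\<Sum>i<N. h i \<omega>))
      = expectation f - expectation g - (\<Sum>i<N. expectation (h i))"
      by (simp only: Bochner_Integration.integral_diff[OF fg sum] Bochner_Integration.integral_diff[OF that(1,2)])
  qed
  have int_gap': "integrable M (\<lambda>\<omega>. w (q k \<omega>) * gap N (q k \<omega>) * (real N * (1 - real N powr (-\<alpha>))))"
    using int_gap by (rule integrable_mult_left)
  have "expectation (\<lambda>\<omega>. exp (\<theta> * min (?Y (q (Suc k) \<omega>)) L))
    \<le> expectation (\<lambda>\<omega>. H (q k \<omega>) - w (q k \<omega>) * gap N (q k \<omega>) * real (a k \<omega>)
      - (\<Sum>i<N. w (q k \<omega>) * ?p (q k \<omega>) i * real (s i k \<omega>)))"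
    by (rule integral_mono_AE[OF int_min _ step]) (rule expand(1)[OF int_H gap_a(1) perp_s(1)])
  also have "\<dots> = expectation (\<lambda>\<omega>. H (q k \<omega>))
      - expectation (\<lambda>\<omega>. w (q k \<omega>) * gap N (q k \<omega>) * real (a k \<omega>))
      - (\<Sum>i<N. expectation (\<lambda>\<omega>. w (q k \<omega>) * ?p (q k \<omega>) i * real (s i k \<omega>)))"
    by (rule expand(2)[OF int_H gap_a(1) perp_s(1)])
  also have "\<dots> = expectation (\<lambda>\<omega>. H (q k \<omega>))
      - expectation (\<lambda>\<omega>. w (q k \<omega>) * gap N (q k \<omega>) * (real N * (1 - real N powr (-\<alpha>))))
      - (\<Sum>i<N. expectation (\<lambda>\<omega>. w (q k \<omega>) * ?p (q k \<omega>) i))"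
    using gap_a(2) perp_s(2) Bochner_Integration.integral_mult_left[OF int_gap, of "real N * (1 - real N powr (-\<alpha>))"]
    by simp
  also have "\<dots> = expectation (\<lambda>\<omega>. H (q k \<omega>)
      - w (q k \<omega>) * gap N (q k \<omega>) * (real N * (1 - real N powr (-\<alpha>)))
      - (\<Sum>i<N. w (q k \<omega>) * ?p (q k \<omega>) i))"
    by (rule expand(2)[OF int_H int_gap' int_perp, symmetric])
  also have "\<dots> \<le> expectation (\<lambda>\<omega>. exp (\<theta> * min (?Y (q k \<omega>)) L)
        + (if ?Y (q k \<omega>) \<le> L then \<theta> * \<delta> / 2 * (5 / 2 * exp (3 / 2) - exp (\<theta> * ?Y (q k \<omega>))) else 0))"
  proof (rule integral_mono)
    show "integrable M (\<lambda>\<omega>. H (q k \<omega>)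
      - w (q k \<omega>) * gap N (q k \<omega>) * (real N * (1 - real N powr (-\<alpha>)))
      - (\<Sum>i<N. w (q k \<omega>) * ?p (q k \<omega>) i))"
      by (rule expand(1)[OF int_H int_gap' int_perp])
    show "integrable M (\<lambda>\<omega>. exp (\<theta> * min (?Y (q k \<omega>)) L)
        + (if ?Y (q k \<omega>) \<le> L then \<theta> * \<delta> / 2 * (5 / 2 * exp (3 / 2) - exp (\<theta> * ?Y (q k \<omega>))) else 0))"
    proof (intro Bochner_Integration.integrable_add int_min int_state[of "\<lambda>x. if ?Y x \<le> L
        then \<theta> * \<delta> / 2 * (5 / 2 * exp (3 / 2) - exp (\<theta> * ?Y x)) else 0"])
      show "(if ?Y x \<le> L then \<theta> * \<delta> / 2 * (5 / 2 * exp (3 / 2) - exp (\<theta> * ?Y x)) else 0)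
          = (if ?Y y \<le> L then \<theta> * \<delta> / 2 * (5 / 2 * exp (3 / 2) - exp (\<theta> * ?Y y)) else 0)"
        if "\<And>i. i < N \<Longrightarrow> x i = y i" for x y
        using lyap_cong[of N x y u] that by simp
      fix x
      have "\<bar>5 / 2 * exp (3 / 2) - exp (\<theta> * ?Y x)\<bar> \<le> 5 / 2 * exp (3 / 2) + exp (\<theta> * L)" if "?Y x \<le> L"
      proof -
        have "0 < exp (\<theta> * ?Y x)" "exp (\<theta> * ?Y x) \<le> exp (\<theta> * L)" "0 < exp (3 / 2 :: real)"
          using that \<theta> by auto
        then show ?thesis by linarith
      qed
      then show "\<bar>if ?Y x \<le> L then \<theta> * \<delta> / 2 * (5 / 2 * exp (3 / 2) - exp (\<theta> * ?Y x)) else 0\<bar>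
          \<le> \<theta> * \<delta> / 2 * (5 / 2 * exp (3 / 2) + exp (\<theta> * L))"
        using \<theta> \<delta> by (auto simp: abs_mult)
    qed
    fix \<omega>
    let ?x = "q k \<omega>"
    have "\<delta> * perp_norm N ?x \<le> (1 - real N powr (-\<alpha>)) * (real N * gap N ?x)"
      using perp_norm_le_gap[OF N_pos, of ?x] perp_norm_nonneg[of N ?x] \<delta> by (intro mult_mono) auto
    then have "w ?x * (\<delta> * perp_norm N ?x) \<le> w ?x * ((1 - real N powr (-\<alpha>)) * (real N * gap N ?x))"
      using w0 by (rule mult_left_mono)
    then have "H ?x - w ?x * gap N ?x * (real N * (1 - real N powr (-\<alpha>))) \<le> H ?x - w ?x * (\<delta> * perp_norm N ?x)"
      by (simp add: mult_ac)
    also have "\<dots> \<le> exp (\<theta> * min (?Y ?x) L)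
        + (if ?Y ?x \<le> L then \<theta> * \<delta> / 2 * (5 / 2 * exp (3 / 2) - exp (\<theta> * ?Y ?x)) else 0)"
      using drift_estimate[OF \<delta>(1) u Y(1)[of ?x] Y(4)[of ?x] \<theta>u]
      by (auto simp: H_def w_def B2)
    finally show "H ?x - w ?x * gap N ?x * (real N * (1 - real N powr (-\<alpha>))) - (\<Sum>i<N. w ?x * ?p ?x i)
      \<le> exp (\<theta> * min (?Y ?x) L)
        + (if ?Y ?x \<le> L then \<theta> * \<delta> / 2 * (5 / 2 * exp (3 / 2) - exp (\<theta> * ?Y ?x)) else 0)"
      by (simp add: sum_distrib_left[symmetric] sum_perp[OF N_pos])
  qed
  finally show ?thesis .
qed

lemma exp_lyap_steady_state:
  assumes ss: "steady_state N M q M' qbar"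
    and \<delta>: "0 < \<delta>" "\<delta> \<le> 1 - real N powr (-\<alpha>)" and A: "Amax \<le> A" "Smax \<le> real N * A"
  defines "B \<equiv> real N powr (3/2) * A"
  defines "u \<equiv> B\<^sup>2 / \<delta>" and "\<theta> \<equiv> \<delta> / (4 * B\<^sup>2)"
  shows "(\<integral>\<^sup>+\<omega>. ennreal (exp (\<theta> * lyap u N (qbar \<omega>))) \<partial>M') \<le> ennreal (5 / 2 * exp (3 / 2))"
proof -
  interpret M': prob_space M'
    using ss by (simp add: steady_state_def)
  have "0 < A"
    using \<delta> A(1) heavy_traffic_le_Amax by linarith
  then have \<theta>: "0 < \<theta>"
    using \<delta> N_pos by (simp add: \<theta>_def B_def)
  let ?Y = "lyap u N" and ?c = "5 / 2 * exp (3 / 2) :: real"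
  have Y_cong: "?Y x = ?Y y" if "\<And>i. i < N \<Longrightarrow> x i = y i" for x y
    using lyap_cong[of N x y u] that by simp
  have meas: "(\<lambda>\<omega>. F (qbar \<omega>)) \<in> borel_measurable M'"
    if "\<And>x y. (\<And>i. i < N \<Longrightarrow> x i = y i) \<Longrightarrow> F x = F y" for F :: "(nat \<Rightarrow> nat) \<Rightarrow> real"
    by (rule measurable_finite_coordinates[where N=N and x=qbar, OF _ that]) (use ss in \<open>auto simp: steady_state_def\<close>)
  have truncated: "(\<integral>\<^sup>+\<omega>. ennreal (if ?Y (qbar \<omega>) \<le> L then exp (\<theta> * ?Y (qbar \<omega>)) else 0) \<partial>M') \<le> ennreal ?c"
    for L
  proof -
    define T where "T x = (if ?Y x \<le> L then exp (\<theta> * ?Y x) else 0)" for x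
    define G where "G x = exp (\<theta> * min (?Y x) L)" for x
    define R where "R x = (if ?Y x \<le> L then \<theta> * \<delta> / 2 * (?c - exp (\<theta> * ?Y x)) else 0)" for x
    have cong: "T x = T y" "G x = G y" "R x = R y" "G x + R x = G y + R y"
      if "\<And>i. i < N \<Longrightarrow> x i = y i" for x y
      using Y_cong[of x y] that by (simp_all add: T_def G_def R_def)
    have T_le: "\<bar>T x\<bar> \<le> exp (\<theta> * L)" and G_le: "\<bar>G x\<bar> \<le> exp (\<theta> * L)" for x
      using \<theta> by (auto simp: T_def G_def)
    have R_le: "\<bar>R x\<bar> \<le> \<theta> * \<delta> / 2 * (?c + exp (\<theta> * L))" for x
    proof -
      have "\<bar>?c - exp (\<theta> * ?Y x)\<bar> \<le> ?c + exp (\<theta> * L)" if "?Y x \<le> L"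
      proof -
        have "0 < exp (\<theta> * ?Y x)" "exp (\<theta> * ?Y x) \<le> exp (\<theta> * L)" "0 < exp (3 / 2 :: real)"
          using that \<theta> by auto
        then show ?thesis by linarith
      qed
      then show ?thesis
        using \<theta> \<delta> by (auto simp: R_def abs_mult)
    qed
    have GR_le: "\<bar>G x + R x\<bar> \<le> exp (\<theta> * L) + \<theta> * \<delta> / 2 * (?c + exp (\<theta> * L))" for x
      using G_le[of x] R_le[of x] by linarith
    have int: "integrable M' (\<lambda>\<omega>. F (qbar \<omega>))"
      if "\<And>x y. (\<And>i. i < N \<Longrightarrow> x i = y i) \<Longrightarrow> F x = F y" "\<And>x. \<bar>F x\<bar> \<le> c"
      for F :: "(nat \<Rightarrow> nat) \<Rightarrow> real" and c
      using meas[OF that(1)] by (rule M'.integrable_const_bound[where B=c, rotated]) (use that(2) in auto)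
    note int_T = int[of T, OF cong(1) T_le] and int_G = int[of G, OF cong(2) G_le] and int_R = int[of R, OF cong(3) R_le]
    have "(\<integral>\<omega>. G (qbar \<omega>) \<partial>M') \<le> (\<integral>\<omega>. G (qbar \<omega>) + R (qbar \<omega>) \<partial>M')"
    proof (rule LIMSEQ_le)
      show "(\<lambda>k. expectation (\<lambda>\<omega>. G (q (Suc k) \<omega>))) \<longlonglongrightarrow> (\<integral>\<omega>. G (qbar \<omega>) \<partial>M')"
        by (rule LIMSEQ_Suc[OF steady_state_tendsto[where F=G, OF ss cong(2) G_le]])
      show "(\<lambda>k. expectation (\<lambda>\<omega>. G (q k \<omega>) + R (q k \<omega>))) \<longlonglongrightarrow> (\<integral>\<omega>. G (qbar \<omega>) + R (qbar \<omega>) \<partial>M')"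
        by (rule steady_state_tendsto[where F="\<lambda>x. G x + R x", OF ss cong(4) GR_le])
      show "\<exists>k0. \<forall>k\<ge>k0. expectation (\<lambda>\<omega>. G (q (Suc k) \<omega>)) \<le> expectation (\<lambda>\<omega>. G (q k \<omega>) + R (q k \<omega>))"
        unfolding G_def R_def \<theta>_def u_def B_def by (intro exI allI impI drift[OF \<delta> A])
    qed
    then have R0: "0 \<le> (\<integral>\<omega>. R (qbar \<omega>) \<partial>M')"
      using int_G int_R by simp
    have "(\<integral>\<omega>. T (qbar \<omega>) \<partial>M') \<le> (\<integral>\<omega>. ?c - 2 / (\<theta> * \<delta>) * R (qbar \<omega>) \<partial>M')"
      using \<theta> \<delta> int_T int_R by (intro integral_mono) (auto simp: T_def R_def)
    also have "\<dots> = ?c - 2 / (\<theta> * \<delta>) * (\<integral>\<omega>. R (qbar \<omega>) \<partial>M')"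
      using int_R by (simp add: M'.prob_space)
    also have "\<dots> \<le> ?c"
      using R0 \<theta> \<delta> by simp
    finally have "(\<integral>\<omega>. T (qbar \<omega>) \<partial>M') \<le> ?c" .
    moreover have "(\<integral>\<^sup>+\<omega>. ennreal (T (qbar \<omega>)) \<partial>M') = ennreal (\<integral>\<omega>. T (qbar \<omega>) \<partial>M')"
      by (rule nn_integral_eq_integral[OF int_T]) (auto simp: T_def)
    ultimately show ?thesis
      by (simp add: T_def ennreal_leI)
  qed
  let ?f = "\<lambda>n \<omega>. ennreal (if ?Y (qbar \<omega>) \<le> real n then exp (\<theta> * ?Y (qbar \<omega>)) else 0)"
  have sup: "(SUP n. ?f n \<omega>) = ennreal (exp (\<theta> * ?Y (qbar \<omega>)))" for \<omega>
  proof (rule antisym)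
    show "(SUP n. ?f n \<omega>) \<le> ennreal (exp (\<theta> * ?Y (qbar \<omega>)))"
      by (rule SUP_least) (simp add: ennreal_leI)
    obtain n where "?Y (qbar \<omega>) \<le> real n"
      using real_arch_simple by blast
    then show "ennreal (exp (\<theta> * ?Y (qbar \<omega>))) \<le> (SUP n. ?f n \<omega>)"
      by (intro SUP_upper2[of n]) auto
  qed
  have "(\<integral>\<^sup>+\<omega>. ennreal (exp (\<theta> * ?Y (qbar \<omega>))) \<partial>M') = (\<integral>\<^sup>+\<omega>. (SUP n. ?f n \<omega>) \<partial>M')"
    by (simp only: sup)
  also have "\<dots> = (SUP n. \<integral>\<^sup>+\<omega>. ?f n \<omega> \<partial>M')"
  proof (rule nn_integral_monotone_convergence_SUP)
    show "incseq ?f"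
      by (auto simp: incseq_def le_fun_def intro!: ennreal_leI)
    show "?f n \<in> borel_measurable M'" for n
    proof (rule measurable_compose[OF meas measurable_ennreal])
      show "(if ?Y x \<le> real n then exp (\<theta> * ?Y x) else 0) = (if ?Y y \<le> real n then exp (\<theta> * ?Y y) else 0)"
        if "\<And>i. i < N \<Longrightarrow> x i = y i" for x y
        using Y_cong[of x y] that by simp
    qed
  qed
  also have "\<dots> \<le> ennreal ?c"
    by (rule SUP_least) (rule truncated)
  finally show ?thesis .
qed

lemma exp_perp_norm_steady_state:
  assumes ss: "steady_state N M q M' qbar"
    and \<delta>: "0 < \<delta>" "\<delta> \<le> 1 - real N powr (-\<alpha>)" and A: "Amax \<le> A" "Smax \<le> real N * A"
  shows "(\<integral>\<^sup>+\<omega>. ennreal (exp (\<delta> / (4 * (real N powr (3/2) * A)\<^sup>2) * perp_norm N (qbar \<omega>))) \<partial>M') \<le> ennreal (exp 4)"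
proof -
  let ?u = "(real N powr (3/2) * A)\<^sup>2 / \<delta>" and ?\<theta> = "\<delta> / (4 * (real N powr (3/2) * A)\<^sup>2)"
  have "(\<integral>\<^sup>+\<omega>. ennreal (exp (?\<theta> * perp_norm N (qbar \<omega>))) \<partial>M')
    \<le> (\<integral>\<^sup>+\<omega>. ennreal (exp (?\<theta> * lyap ?u N (qbar \<omega>))) \<partial>M')"
    using \<delta>(1) lyap_bounds(2)[of ?u N]
    by (intro nn_integral_mono ennreal_leI) (auto intro!: divide_right_mono mult_left_mono)
  also have "\<dots> \<le> ennreal (5 / 2 * exp (3 / 2))"
    by (rule exp_lyap_steady_state[OF ss \<delta> A])
  also have "\<dots> \<le> ennreal (exp 4)"
  proof (rule ennreal_leI)
    have "5 / 2 * exp (3 / 2) \<le> exp (3 / 2) * exp (3 / 2 :: real)"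
      using exp_ge_add_one_self[of "3 / 2 :: real"] by (intro mult_right_mono) auto
    also have "\<dots> \<le> exp 4"
      by (simp add: exp_add[symmetric])
    finally show "5 / 2 * exp (3 / 2) \<le> exp (4 :: real)" .
  qed
  finally show ?thesis .
qed

end

lemma power_div_fact_le_exp:
  fixes x :: real
  assumes "0 \<le> x"
  shows "x ^ n / fact n \<le> exp x"
proof -
  have "(\<Sum>k\<in>{n}. inverse (fact k) *\<^sub>R x ^ k) \<le> (\<Sum>k. inverse (fact k) *\<^sub>R x ^ k)"
    using assms by (intro sum_le_suminf summable_exp_generic) auto
  then show ?thesis
    by (simp add: exp_def divide_inverse mult.commute)
qed

lemma (in prob_space) moment_le_of_exp_moment:
  assumes Z[measurable]: "Z \<in> borel_measurable M" and nonneg: "\<And>\<omega>. 0 \<le> Z \<omega>"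
    and \<theta>: "0 < \<theta>" and K: "1 \<le> K" and exp_moment: "(\<integral>\<^sup>+\<omega>. ennreal (exp (\<theta> * Z \<omega>)) \<partial>M) \<le> ennreal K"
    and r: "1 \<le> r"
  shows "integrable M (\<lambda>\<omega>. Z \<omega> ^ r)"
    and "expectation (\<lambda>\<omega>. Z \<omega> ^ r) powr (1 / real r) \<le> K * real r / \<theta>"
proof -
  have int: "integrable M (\<lambda>\<omega>. exp (\<theta> * Z \<omega>))"
    using exp_moment by (intro integrableI_bounded) (auto simp: less_top[symmetric] top_unique)
  have exp_le: "expectation (\<lambda>\<omega>. exp (\<theta> * Z \<omega>)) \<le> K"
    using exp_moment K nn_integral_eq_integral[OF int] by simp
  have le: "Z \<omega> ^ r \<le> (real r / \<theta>) ^ r * exp (\<theta> * Z \<omega>)" for \<omega>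
  proof -
    have "(\<theta> * Z \<omega>) ^ r \<le> fact r * exp (\<theta> * Z \<omega>)"
      using power_div_fact_le_exp[of "\<theta> * Z \<omega>" r] \<theta> nonneg[of \<omega>] by (simp add: field_simps)
    also have "\<dots> \<le> real r ^ r * exp (\<theta> * Z \<omega>)"
      using fact_le_power[of r, where 'a=real] by (intro mult_right_mono) auto
    finally show ?thesis
      using \<theta> by (simp add: power_mult_distrib power_divide field_simps)
  qed
  show int_r: "integrable M (\<lambda>\<omega>. Z \<omega> ^ r)"
    using le nonneg
    by (intro Bochner_Integration.integrable_bound[OF integrable_mult_right[OF int, of "(real r / \<theta>) ^ r"]])
      (auto simp: abs_mult \<theta> less_imp_le)
  have "expectation (\<lambda>\<omega>. Z \<omega> ^ r) \<le> expectation (\<lambda>\<omega>. (real r / \<theta>) ^ r * exp (\<theta> * Z \<omega>))"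
    by (rule integral_mono[OF int_r integrable_mult_right[OF int] le])
  also have "\<dots> \<le> (real r / \<theta>) ^ r * K"
    using exp_le \<theta> by (simp add: mult_left_mono)
  also have "\<dots> \<le> (real r / \<theta>) ^ r * K ^ r"
    using K r \<theta> by (intro mult_left_mono self_le_power) auto
  also have "\<dots> = (K * real r / \<theta>) ^ r"
    by (simp add: power_mult_distrib power_divide)
  finally have "expectation (\<lambda>\<omega>. Z \<omega> ^ r) powr (1 / real r) \<le> ((K * real r / \<theta>) ^ r) powr (1 / real r)"
    using nonneg by (intro powr_mono2) auto
  also have "\<dots> = K * real r / \<theta>"
    using K r \<theta> by (simp add: powr_realpow[symmetric] powr_powr)
  finally show "expectation (\<lambda>\<omega>. Z \<omega> ^ r) powr (1 / real r) \<le> K * real r / \<theta>" .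
qed

lemma (in prob_space) exp_moment_interpolate:
  assumes Z[measurable]: "Z \<in> borel_measurable M"
    and exp_moment: "(\<integral>\<^sup>+\<omega>. ennreal (exp (Z \<omega>)) \<partial>M) \<le> ennreal (exp c)"
    and p: "0 \<le> p" "p \<le> 1"
  shows "(\<integral>\<^sup>+\<omega>. ennreal (exp (p * Z \<omega>)) \<partial>M) \<le> ennreal (exp (p * c))"
proof -
  let ?a = "exp (p * c) * (1 - p)" and ?b = "exp (p * c) * p * exp (- c)"
  have "exp (p * Z \<omega>) \<le> ?a + ?b * exp (Z \<omega>)" for \<omega>
  proof -
    have "exp ((1 - p) *\<^sub>R 0 + p *\<^sub>R (Z \<omega> - c)) \<le> (1 - p) * exp 0 + p * exp (Z \<omega> - c)"
      by (rule convex_onD[OF exp_convex]) (use p in auto)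
    then have "exp (p * c) * exp (p * (Z \<omega> - c)) \<le> exp (p * c) * (1 - p + p * exp (Z \<omega> - c))"
      by simp
    then show ?thesis
      by (simp add: exp_add[symmetric] algebra_simps)
  qed
  then have "(\<integral>\<^sup>+\<omega>. ennreal (exp (p * Z \<omega>)) \<partial>M) \<le> (\<integral>\<^sup>+\<omega>. ennreal ?a + ennreal ?b * ennreal (exp (Z \<omega>)) \<partial>M)"
    using p by (intro nn_integral_mono) (simp add: ennreal_mult[symmetric] ennreal_plus[symmetric] ennreal_leI del: ennreal_plus)
  also have "\<dots> = ennreal ?a + ennreal ?b * (\<integral>\<^sup>+\<omega>. ennreal (exp (Z \<omega>)) \<partial>M)"
    by (simp add: nn_integral_add nn_integral_cmult emeasure_space_1)
  also have "\<dots> \<le> ennreal ?a + ennreal ?b * ennreal (exp c)"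
    by (intro add_left_mono mult_left_mono exp_moment) auto
  also have "\<dots> = ennreal (?a + ?b * exp c)"
    using p by (simp add: ennreal_mult[symmetric] ennreal_plus[symmetric] del: ennreal_plus)
  also have "?a + ?b * exp c = exp (p * c)"
    by (simp add: exp_minus algebra_simps)
  finally show ?thesis .
qed

lemma exp_le_geometric_quotient:
  fixes \<delta> B \<tau> K :: real
  assumes \<delta>: "0 < \<delta>" and B: "0 < B" and \<tau>: "0 \<le> \<tau>" and K: "0 \<le> K"
  shows "ennreal (exp (16 * \<tau> * B\<^sup>2 / \<delta>))
    \<le> ennreal (\<delta> * exp K) / ennreal (\<delta> + 4 * B * (1 - exp (4 * \<tau> * B)))"
proof -
  let ?D = "\<delta> + 4 * B * (1 - exp (4 * \<tau> * B))" and ?t = "16 * \<tau> * B\<^sup>2 / \<delta>"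
  show ?thesis
  proof (cases "0 < ?D")
    case False
    then have "ennreal ?D = 0"
      by (simp add: ennreal_neg)
    moreover have "ennreal (\<delta> * exp K) \<noteq> 0"
      using \<delta> by simp
    ultimately have "ennreal (\<delta> * exp K) / ennreal ?D = top"
      by (simp only: ennreal_divide_eq_top_iff) simp
    then show ?thesis
      by (simp only: top_greatest)
  next
    case True
    have "4 * \<tau> * B \<le> exp (4 * \<tau> * B) - 1"
      using exp_ge_add_one_self[of "4 * \<tau> * B"] by linarith
    then have "4 * B * (4 * \<tau> * B) \<le> 4 * B * (exp (4 * \<tau> * B) - 1)"
      using B by (intro mult_left_mono) auto
    then have "?D \<le> \<delta> - 4 * B * (4 * \<tau> * B)"
      by (simp add: right_diff_distrib)
    also have "\<dots> = \<delta> * (1 - ?t)"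
      using \<delta> by (simp add: power2_eq_square field_simps)
    also have "\<dots> \<le> \<delta> * exp (- ?t)"
      using exp_ge_add_one_self[of "- ?t"] \<delta> by (intro mult_left_mono) auto
    finally have "exp ?t * ?D \<le> exp ?t * (\<delta> * exp (- ?t))"
      by (intro mult_left_mono) auto
    also have "\<dots> = \<delta>"
      by (simp add: exp_minus)
    also have "\<dots> \<le> \<delta> * exp K"
      using \<delta> K by simp
    finally have "exp ?t \<le> \<delta> * exp K / ?D"
      using True by (simp only: pos_le_divide_eq)
    then show ?thesis
      using True \<delta> by (simp only: divide_ennreal ennreal_leI mult_nonneg_nonneg exp_ge_zero less_imp_le)
  qed
qed

lemma measurable_perp_norm_steady_state:
  assumes "steady_state N M q M' qbar"
  shows "(\<lambda>\<omega>. perp_norm N (qbar \<omega>)) \<in> borel_measurable M'"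
proof (rule measurable_finite_coordinates[where N=N and x=qbar])
  show "(\<lambda>\<omega>. qbar \<omega> i) \<in> M' \<rightarrow>\<^sub>M count_space UNIV" if "i < N" for i
    using assms that by (simp add: steady_state_def)
qed (rule perp_norm_cong)

theorem proposition1:
  fixes M :: "nat \<Rightarrow> 'w measure" and Mbar :: "nat \<Rightarrow> 'v measure"
    and \<alpha> \<delta> Amax Smax \<sigma>a \<sigma>s :: real and N0 :: nat
    and a :: "nat \<Rightarrow> nat \<Rightarrow> 'w \<Rightarrow> nat"
    and s :: "nat \<Rightarrow> nat \<Rightarrow> nat \<Rightarrow> 'w \<Rightarrow> nat"
    and istar :: "nat \<Rightarrow> nat \<Rightarrow> 'w \<Rightarrow> nat"
    and q :: "nat \<Rightarrow> nat \<Rightarrow> 'w \<Rightarrow> nat \<Rightarrow> nat"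
    and qbar :: "nat \<Rightarrow> 'v \<Rightarrow> nat \<Rightarrow> nat"
  assumes "0 < \<alpha>" and "0 < \<delta>" and "\<delta> < 1"
    and "\<forall>N\<ge>N0. \<delta> \<le> 1 - real N powr (-\<alpha>)"
    and "\<forall>N\<ge>N0. jsq_system (M N) N \<alpha> Amax Smax \<sigma>a \<sigma>s (a N) (s N) (istar N) (q N)"
    and "\<forall>N\<ge>N0. steady_state N (M N) (q N) (Mbar N) (qbar N)"
  shows "(\<exists>C::real. \<forall>N\<ge>N0. \<forall>r::nat. r \<ge> 1 \<longrightarrow>
            integrable (Mbar N) (\<lambda>\<omega>. perp_norm N (qbar N \<omega>) ^ r) \<and>
            (\<integral>\<omega>. perp_norm N (qbar N \<omega>) ^ r \<partial>Mbar N) powr (1 / real r) \<le> C * real r * real N ^ 3) \<and>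
         (\<forall>N\<ge>N0. \<forall>\<theta>::real. Smax \<le> real N * Amax \<longrightarrow> 0 \<le> \<theta> \<longrightarrow>
            \<theta> \<le> 1 / (4 * Amax * real N powr (5/2 - \<alpha>)) * ln (1 + \<delta> / (4 * Amax * real N powr (3/2))) \<longrightarrow>
            (\<integral>\<^sup>+\<omega>. ennreal (exp (\<theta> * real N powr (1 - \<alpha>) * perp_norm N (qbar N \<omega>))) \<partial>Mbar N)
            \<le> ennreal (\<delta> * exp (2 * \<theta> * real N powr (3 - \<alpha>) / \<delta>)) /
              ennreal (\<delta> + 4 * Amax * real N powr (3/2) * (1 - exp (4 * \<theta> * Amax * real N powr (5/2 - \<alpha>)))))"
proof (intro conjI exI allI impI)
  fix N r :: nat
  assume N: "N0 \<le> N" and r: "1 \<le> r"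
  interpret jsq_system "M N" N \<alpha> Amax Smax \<sigma>a \<sigma>s "a N" "s N" "istar N" "q N"
    using assms N by blast
  have ss: "steady_state N (M N) (q N) (Mbar N) (qbar N)" and \<delta>: "\<delta> \<le> 1 - real N powr (-\<alpha>)"
    using assms N by auto
  interpret bar: prob_space "Mbar N"
    using ss by (simp add: steady_state_def)
  let ?A = "max Amax Smax"
  let ?\<theta> = "\<delta> / (4 * (real N powr (3/2) * ?A)\<^sup>2)"
  have A: "0 < ?A"
    using \<delta> \<open>0 < \<delta>\<close> heavy_traffic_le_Amax by linarith
  have "1 * ?A \<le> real N * ?A"
    by (rule mult_right_mono) (use A N_pos in linarith)+
  then have Smax: "Smax \<le> real N * ?A"
    by linarith
  note exp_moment = exp_perp_norm_steady_state[OF ss \<open>0 < \<delta>\<close> \<delta> max.cobounded1 Smax]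
  have \<theta>: "0 < ?\<theta>"
    using A N_pos \<open>0 < \<delta>\<close> by simp
  have K: "1 \<le> exp (4::real)"
    by simp
  have meas: "(\<lambda>\<omega>. perp_norm N (qbar N \<omega>)) \<in> borel_measurable (Mbar N)"
    by (rule measurable_perp_norm_steady_state[OF ss])
  note moment = bar.moment_le_of_exp_moment[OF meas perp_norm_nonneg \<theta> K exp_moment r]
  show "integrable (Mbar N) (\<lambda>\<omega>. perp_norm N (qbar N \<omega>) ^ r)"
    by (rule moment(1))
  have "(real N powr (3/2))\<^sup>2 = real N ^ 3"
    using N_pos by (simp add: power2_eq_square powr_add[symmetric])
  then have "exp 4 * real r / ?\<theta> = 4 * exp 4 * ?A\<^sup>2 / \<delta> * real r * real N ^ 3"
    by (simp add: power_mult_distrib mult_ac)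
  then show "(\<integral>\<omega>. perp_norm N (qbar N \<omega>) ^ r \<partial>Mbar N) powr (1 / real r)
      \<le> 4 * exp 4 * ?A\<^sup>2 / \<delta> * real r * real N ^ 3"
    using moment(2) by (simp only:)
next
  fix N :: nat and \<theta> :: real
  assume N: "N0 \<le> N" and Smax: "Smax \<le> real N * Amax" and "0 \<le> \<theta>"
    and \<theta>_le: "\<theta> \<le> 1 / (4 * Amax * real N powr (5/2 - \<alpha>)) * ln (1 + \<delta> / (4 * Amax * real N powr (3/2)))"
  interpret jsq_system "M N" N \<alpha> Amax Smax \<sigma>a \<sigma>s "a N" "s N" "istar N" "q N"
    using assms N by blast
  have ss: "steady_state N (M N) (q N) (Mbar N) (qbar N)" and \<delta>: "\<delta> \<le> 1 - real N powr (-\<alpha>)"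
    using assms N by auto
  interpret bar: prob_space "Mbar N"
    using ss by (simp add: steady_state_def)
  have A: "0 < Amax"
    using \<delta> \<open>0 < \<delta>\<close> heavy_traffic_le_Amax by linarith
  define B where "B = real N powr (3/2) * Amax"
  define \<tau> where "\<tau> = \<theta> * real N powr (1 - \<alpha>)"
  have B: "0 < B" and \<tau>: "0 \<le> \<tau>"
    using A N_pos \<open>0 \<le> \<theta>\<close> by (auto simp: B_def \<tau>_def)
  have NB: "real N powr (5/2 - \<alpha>) = real N powr (3/2) * real N powr (1 - \<alpha>)"
    by (simp add: powr_add[symmetric])
  have "\<theta> \<le> 1 / (4 * (B * real N powr (1 - \<alpha>))) * ln (1 + \<delta> / (4 * B))"
    using \<theta>_le unfolding NB by (simp add: B_def mult_ac)
  also have "\<dots> \<le> 1 / (4 * (B * real N powr (1 - \<alpha>))) * (\<delta> / (4 * B))"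
    using B \<open>0 < \<delta>\<close> by (intro mult_left_mono ln_add_one_self_le_self) auto
  finally have \<tau>_le: "16 * \<tau> * B\<^sup>2 / \<delta> \<le> 1"
    using B N_pos \<open>0 < \<delta>\<close> by (simp add: \<tau>_def power2_eq_square field_simps)
  define p where "p = 4 * \<tau> * B\<^sup>2 / \<delta>"
  have p: "0 \<le> p" "p \<le> 1"
    using \<tau>_le \<tau> \<open>0 < \<delta>\<close> by (auto simp: p_def)
  have p_mult: "p * (\<delta> / (4 * B\<^sup>2) * z) = \<tau> * z" for z
    using B \<open>0 < \<delta>\<close> by (simp add: p_def)
  have meas: "(\<lambda>\<omega>. \<delta> / (4 * B\<^sup>2) * perp_norm N (qbar N \<omega>)) \<in> borel_measurable (Mbar N)"
    using measurable_perp_norm_steady_state[OF ss] by simp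
  note exp_moment = exp_perp_norm_steady_state[OF ss \<open>0 < \<delta>\<close> \<delta> order_refl Smax, folded B_def]
  have "(\<integral>\<^sup>+\<omega>. ennreal (exp (\<tau> * perp_norm N (qbar N \<omega>))) \<partial>Mbar N) \<le> ennreal (exp (p * 4))"
    using bar.exp_moment_interpolate[OF meas exp_moment p] by (simp only: p_mult)
  also have "p * 4 = 16 * \<tau> * B\<^sup>2 / \<delta>"
    by (simp add: p_def)
  also have "ennreal (exp (16 * \<tau> * B\<^sup>2 / \<delta>))
    \<le> ennreal (\<delta> * exp (2 * \<theta> * real N powr (3 - \<alpha>) / \<delta>)) / ennreal (\<delta> + 4 * B * (1 - exp (4 * \<tau> * B)))"
    using B \<tau> \<open>0 < \<delta>\<close> \<open>0 \<le> \<theta>\<close> by (intro exp_le_geometric_quotient) auto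
  also have "4 * B = 4 * Amax * real N powr (3/2)"
    by (simp add: B_def)
  also have "4 * \<tau> * B = 4 * \<theta> * Amax * real N powr (5/2 - \<alpha>)"
    unfolding NB by (simp add: \<tau>_def B_def mult_ac)
  finally show "(\<integral>\<^sup>+\<omega>. ennreal (exp (\<theta> * real N powr (1 - \<alpha>) * perp_norm N (qbar N \<omega>))) \<partial>Mbar N)
      \<le> ennreal (\<delta> * exp (2 * \<theta> * real N powr (3 - \<alpha>) / \<delta>)) /
        ennreal (\<delta> + 4 * Amax * real N powr (3/2) * (1 - exp (4 * \<theta> * Amax * real N powr (5/2 - \<alpha>))))"
    by (simp only: \<tau>_def)
qed

end
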